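(* Let $\mathbf S$ be a left-handed (respectively right-handed) skew Boolean algebra, let $X\subseteq S$ be a generating set of $\mathbf S$ and let $\pi\colon\mathbf S\to\mathbf S/\mathcal D$ be the canonical homomorphism. Then the following statements are equivalent: (i) $\mathbf S$ is freely generated by $X$ (in the variety of left-handed, respectively right-handed, skew Boolean algebras). (ii) For every finite subset $Y$ of $X$, the subalgebra $\langle Y\rangle$ generated by $Y$ is free on $Y$ (in the same variety). (iii) For every subset $\{x_1,\dots,x_n\}$ of $n$ distinct elements in $X$, their evaluations in the $n2^{n-1}$ atomic terms on $n$ variables produce $n2^{n-1}$ distinct non-zero outcomes in $\mathbf S$. (iv) $\mathbf S/\mathcal D$ is freely generated by $\pi(X)$ (as a generalized Boolean algebra) and for any $x\neq y$ in $X$ and any $a\in S$, if $a\le x$ and $a\le y$, then $a=0$. (v) $\mathbf S/\mathcal D$ is freely generated by $\pi(X)$ (as a generalized Boolean algebra) and for any $x\ne y$ in $X$, $x\cap y$ exists and equals $0$.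
   Context: A skew lattice is an algebra $(S;\wedge,\vee)$ with associative binary operations satisfying $x\wedge(x\vee y)=x=(y\vee x)\wedge x$ and $x\vee(x\wedge y)=x=(y\wedge x)\vee x$. A skew Boolean algebra is an algebra $(S;\wedge,\vee,\setminus,0)$ such that $(S;\wedge,\vee)$ is a skew lattice satisfying $x\wedge(y\vee z)=(x\wedge y)\vee(x\wedge z)$ and $(x\vee y)\wedge z=(x\wedge z)\vee(y\wedge z)$, $0$ satisfies $0\wedge x=0=x\wedge 0$ and $0\vee x=x=x\vee 0$, and $(x\wedge y\wedge x)\vee(x\setminus y)=x$, $(x\wedge y\wedge x)\wedge(x\setminus y)=0=(x\setminus y)\wedge(x\wedge y\wedge x)$. It is left-handed if $x\wedge y\wedge x=x\wedge y$ and $x\vee y\vee x=y\vee x$ hold, right-handed if $x\wedge y\wedge x=y\wedge x$ and $x\vee y\vee x=x\vee y$ hold; it is a generalized Boolean algebra if $\wedge$ and $\vee$ are commutative. Each of these classes is a variety. An algebra $\mathbf A$ of a variety is free on (freely generated by) $X\subseteq A$ if every map from $X$ to an algebra $\mathbf B$ of the variety extends uniquely to a homomorphism $\mathbf A\to\mathbf B$. Natural partial order: $x\ge y$ iff $x\wedge y=y=y\wedge x$. If the greatest lower bound of $e,f$ in this order exists it is denoted $e\cap f$. The congruence $\mathcal D$: $x\mathrel{\mathcal D}y$ iff $x\wedge y\wedge x=x$ and $y\wedge x\wedge y=y$; the quotient $\mathbf S/\mathcal D$ is a generalized Boolean algebra. Atomic terms on $n$ variables $x_1,\dots,x_n$: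 the terms $(y_1\wedge\dots\wedge y_k)\setminus(y_{k+1}\vee\dots\vee y_n)$, where $1\le k\le n$ and $(y_1,\dots,y_n)$ is a permutation of $(x_1,\dots,x_n)$ (meaning $y_1\wedge\dots\wedge y_n$ if $k=n$). In the left-handed case two such terms are identified (they agree in every left-handed algebra) when they have the same set $\{y_1,\dots,y_k\}$ and the same first variable $y_1$; in the right-handed case, when they have the same set $\{y_1,\dots,y_k\}$ and the same last variable $y_k$. This leaves $n2^{n-1}$ atomic terms.
   Formalization: In (iv) and (v), "S/D is freely generated by π(X)" also requires π to be injective on X; without this the claim fails for the left-handed S={0,a,b} with a∧b=a, b∧a=b and X={a,b}. *)

theory Defs
  imports "HOL-Algebra.Congruence" "HOL-Library.FuncSet" "HOL-Combinatorics.Multiset_Permutations"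
begin

section \<open>Skew Boolean algebras\<close>

record 'a skew_alg = "'a partial_object" +
  meet :: "'a \<Rightarrow> 'a \<Rightarrow> 'a"  (infixl \<open>\<sqinter>\<index>\<close> 70)
  join :: "'a \<Rightarrow> 'a \<Rightarrow> 'a"  (infixl \<open>\<squnion>\<index>\<close> 65)
  diff :: "'a \<Rightarrow> 'a \<Rightarrow> 'a"  (infixl \<open>\<setminus>\<index>\<close> 65)
  zero :: 'a  (\<open>\<zero>\<index>\<close>)

locale skew_lattice =
  fixes S :: "'a skew_alg" (structure)
  assumes meet_closed: "\<lbrakk>x \<in> carrier S; y \<in> carrier S\<rbrakk> \<Longrightarrow> x \<sqinter> y \<in> carrier S"
    and join_closed: "\<lbrakk>x \<in> carrier S; y \<in> carrier S\<rbrakk> \<Longrightarrow> x \<squnion> y \<in> carrier S"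
    and meet_assoc: "\<lbrakk>x \<in> carrier S; y \<in> carrier S; z \<in> carrier S\<rbrakk>
        \<Longrightarrow> (x \<sqinter> y) \<sqinter> z = x \<sqinter> (y \<sqinter> z)"
    and join_assoc: "\<lbrakk>x \<in> carrier S; y \<in> carrier S; z \<in> carrier S\<rbrakk>
        \<Longrightarrow> (x \<squnion> y) \<squnion> z = x \<squnion> (y \<squnion> z)"
    and meet_join_absorb: "\<lbrakk>x \<in> carrier S; y \<in> carrier S\<rbrakk> \<Longrightarrow> x \<sqinter> (x \<squnion> y) = x"
    and join_meet_absorb: "\<lbrakk>x \<in> carrier S; y \<in> carrier S\<rbrakk> \<Longrightarrow> (y \<squnion> x) \<sqinter> x = x"
    and join_absorb_meet: "\<lbrakk>x \<in> carrier S; y \<in> carrier S\<rbrakk> \<Longrightarrow> x \<squnion> (x \<sqinter> y) = x"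
    and meet_absorb_join: "\<lbrakk>x \<in> carrier S; y \<in> carrier S\<rbrakk> \<Longrightarrow> (y \<sqinter> x) \<squnion> x = x"

locale skew_boolean_algebra = skew_lattice +
  assumes diff_closed: "\<lbrakk>x \<in> carrier S; y \<in> carrier S\<rbrakk> \<Longrightarrow> x \<setminus> y \<in> carrier S"
    and zero_closed: "\<zero> \<in> carrier S"
    and distrib_left: "\<lbrakk>x \<in> carrier S; y \<in> carrier S; z \<in> carrier S\<rbrakk>
        \<Longrightarrow> x \<sqinter> (y \<squnion> z) = (x \<sqinter> y) \<squnion> (x \<sqinter> z)"
    and distrib_right: "\<lbrakk>x \<in> carrier S; y \<in> carrier S; z \<in> carrier S\<rbrakk>
        \<Longrightarrow> (x \<squnion> y) \<sqinter> z = (x \<sqinter> z) \<squnion> (y \<sqinter> z)"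
    and zero_meet: "x \<in> carrier S \<Longrightarrow> \<zero> \<sqinter> x = \<zero>"
    and meet_zero: "x \<in> carrier S \<Longrightarrow> x \<sqinter> \<zero> = \<zero>"
    and zero_join: "x \<in> carrier S \<Longrightarrow> \<zero> \<squnion> x = x"
    and join_zero: "x \<in> carrier S \<Longrightarrow> x \<squnion> \<zero> = x"
    and meet_join_diff: "\<lbrakk>x \<in> carrier S; y \<in> carrier S\<rbrakk>
        \<Longrightarrow> (x \<sqinter> y \<sqinter> x) \<squnion> (x \<setminus> y) = x"
    and meet_meet_diff: "\<lbrakk>x \<in> carrier S; y \<in> carrier S\<rbrakk>
        \<Longrightarrow> (x \<sqinter> y \<sqinter> x) \<sqinter> (x \<setminus> y) = \<zero>"
    and diff_meet_meet: "\<lbrakk>x \<in> carrier S; y \<in> carrier S\<rbrakk>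
        \<Longrightarrow> (x \<setminus> y) \<sqinter> (x \<sqinter> y \<sqinter> x) = \<zero>"

locale left_handed_sba = skew_boolean_algebra +
  assumes left_meet: "\<lbrakk>x \<in> carrier S; y \<in> carrier S\<rbrakk> \<Longrightarrow> x \<sqinter> y \<sqinter> x = x \<sqinter> y"
    and left_join: "\<lbrakk>x \<in> carrier S; y \<in> carrier S\<rbrakk> \<Longrightarrow> x \<squnion> y \<squnion> x = y \<squnion> x"

locale right_handed_sba = skew_boolean_algebra +
  assumes right_meet: "\<lbrakk>x \<in> carrier S; y \<in> carrier S\<rbrakk> \<Longrightarrow> x \<sqinter> y \<sqinter> x = y \<sqinter> x"
    and right_join: "\<lbrakk>x \<in> carrier S; y \<in> carrier S\<rbrakk> \<Longrightarrow> x \<squnion> y \<squnion> x = x \<squnion> y"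

locale generalized_boolean_algebra = skew_boolean_algebra +
  assumes meet_comm: "\<lbrakk>x \<in> carrier S; y \<in> carrier S\<rbrakk> \<Longrightarrow> x \<sqinter> y = y \<sqinter> x"
    and join_comm: "\<lbrakk>x \<in> carrier S; y \<in> carrier S\<rbrakk> \<Longrightarrow> x \<squnion> y = y \<squnion> x"

text \<open>
  Varieties are named by a datatype, so that one and the same variety can be referred to
  at several carrier types.
\<close>

datatype sba_variety = Left_Handed | Right_Handed | Generalized_Boolean

primrec in_variety :: "sba_variety \<Rightarrow> 'a skew_alg \<Rightarrow> bool" where
  "in_variety Left_Handed A = left_handed_sba A"
| "in_variety Right_Handed A = right_handed_sba A"
| "in_variety Generalized_Boolean A = generalized_boolean_algebra A"


section \<open>Subalgebras, homomorphisms, freeness\<close>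

inductive_set generated :: "'a skew_alg \<Rightarrow> 'a set \<Rightarrow> 'a set" for S (structure) and X where
  gen: "x \<in> X \<Longrightarrow> x \<in> generated S X"
| zero: "\<zero> \<in> generated S X"
| meet: "\<lbrakk>x \<in> generated S X; y \<in> generated S X\<rbrakk> \<Longrightarrow> x \<sqinter> y \<in> generated S X"
| join: "\<lbrakk>x \<in> generated S X; y \<in> generated S X\<rbrakk> \<Longrightarrow> x \<squnion> y \<in> generated S X"
| diff: "\<lbrakk>x \<in> generated S X; y \<in> generated S X\<rbrakk> \<Longrightarrow> x \<setminus> y \<in> generated S X"

definition generated_subalgebra :: "'a skew_alg \<Rightarrow> 'a set \<Rightarrow> 'a skew_alg" where
  "generated_subalgebra S X = S\<lparr>carrier := generated S X\<rparr>"

definition sba_hom :: "'a skew_alg \<Rightarrow> 'b skew_alg \<Rightarrow> ('a \<Rightarrow> 'b) set" where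
  "sba_hom A B = {h \<in> carrier A \<rightarrow> carrier B.
     h \<zero>\<^bsub>A\<^esub> = \<zero>\<^bsub>B\<^esub> \<and>
     (\<forall>x\<in>carrier A. \<forall>y\<in>carrier A.
        h (x \<sqinter>\<^bsub>A\<^esub> y) = h x \<sqinter>\<^bsub>B\<^esub> h y \<and>
        h (x \<squnion>\<^bsub>A\<^esub> y) = h x \<squnion>\<^bsub>B\<^esub> h y \<and>
        h (x \<setminus>\<^bsub>A\<^esub> y) = h x \<setminus>\<^bsub>B\<^esub> h y)}"

text \<open>
  HOL cannot quantify over all algebras of all types inside a formula, so freeness is
  tested against all algebras of the variety whose carrier is a set over a type \<open>'b\<close>,
  which plays the role of a universe and is an explicit parameter.  Statements about it are
  meant for an arbitrary infinite \<open>'b\<close>, hence for arbitrarily large universes; algebras over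
  a smaller type have isomorphic copies there.  (Over a one-element type the condition would
  be void.)  The homomorphism is made \<^const>\<open>extensional\<close> since it is unique only on the
  carrier.
\<close>

definition free_on ::
    "'b itself \<Rightarrow> sba_variety \<Rightarrow> 'a skew_alg \<Rightarrow> 'a set \<Rightarrow> bool" where
  "free_on U V A X \<longleftrightarrow>
     in_variety V A \<and> X \<subseteq> carrier A \<and>
     (\<forall>(B :: 'b skew_alg) f. in_variety V B \<and> f \<in> X \<rightarrow> carrier B \<longrightarrow>
        (\<exists>!h. h \<in> sba_hom A B \<and> h \<in> extensional (carrier A) \<and> (\<forall>x\<in>X. h x = f x)))"


section \<open>Natural partial order and the quotient by D\<close>

definition nat_le :: "'a skew_alg \<Rightarrow> 'a \<Rightarrow> 'a \<Rightarrow> bool" where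
  "nat_le S y x \<longleftrightarrow> meet S x y = y \<and> meet S y x = y"

definition is_glb :: "'a skew_alg \<Rightarrow> 'a \<Rightarrow> 'a \<Rightarrow> 'a \<Rightarrow> bool" where
  "is_glb S e f g \<longleftrightarrow> g \<in> carrier S \<and> nat_le S g e \<and> nat_le S g f \<and>
     (\<forall>a\<in>carrier S. nat_le S a e \<and> nat_le S a f \<longrightarrow> nat_le S a g)"

definition D_rel :: "'a skew_alg \<Rightarrow> ('a \<times> 'a) set" where
  "D_rel S = {(x, y). x \<in> carrier S \<and> y \<in> carrier S \<and>
     x \<sqinter>\<^bsub>S\<^esub> y \<sqinter>\<^bsub>S\<^esub> x = x \<and> y \<sqinter>\<^bsub>S\<^esub> x \<sqinter>\<^bsub>S\<^esub> y = y}"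

definition D_proj :: "'a skew_alg \<Rightarrow> 'a \<Rightarrow> 'a set" where
  "D_proj S x = D_rel S `` {x}"

text \<open>
  The operations of the quotient are induced by those on representatives; as D is a
  congruence, each of the unions below is a union of equal classes.
\<close>

definition D_quotient :: "'a skew_alg \<Rightarrow> 'a set skew_alg" where
  "D_quotient S =
     \<lparr>carrier = carrier S // D_rel S,
      meet = (\<lambda>P Q. \<Union>x\<in>P. \<Union>y\<in>Q. D_proj S (x \<sqinter>\<^bsub>S\<^esub> y)),
      join = (\<lambda>P Q. \<Union>x\<in>P. \<Union>y\<in>Q. D_proj S (x \<squnion>\<^bsub>S\<^esub> y)),
      diff = (\<lambda>P Q. \<Union>x\<in>P. \<Union>y\<in>Q. D_proj S (x \<setminus>\<^bsub>S\<^esub> y)),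
      zero = D_proj S \<zero>\<^bsub>S\<^esub>\<rparr>"

text \<open>
  \<open>\<pi>(X)\<close> has to be read as the family of the \<open>\<pi>(x)\<close> indexed by \<open>X\<close>, i.e. distinct elements
  of \<open>X\<close> are distinct free generators.  For the bare image set, the left-handed algebra
  \<open>{0, a, b}\<close> with \<open>a \<sqinter> b = a\<close>, \<open>b \<sqinter> a = b\<close> and \<open>X = {a, b}\<close> has its quotient free on the
  one-element set \<open>\<pi>(X)\<close> and \<open>a \<inter> b = 0\<close>, but it is not free on \<open>X\<close>.
\<close>

definition quotient_free_on_image :: "'b itself \<Rightarrow> 'a skew_alg \<Rightarrow> 'a set \<Rightarrow> bool" where
  "quotient_free_on_image U S X \<longleftrightarrow>
     inj_on (D_proj S) X \<and> free_on U Generalized_Boolean (D_quotient S) (D_proj S ` X)"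


section \<open>Atomic terms\<close>

definition list_meet :: "'a skew_alg \<Rightarrow> 'a list \<Rightarrow> 'a" where
  "list_meet S ys = foldl (meet S) (hd ys) (tl ys)"

definition list_join :: "'a skew_alg \<Rightarrow> 'a list \<Rightarrow> 'a" where
  "list_join S ys = foldl (join S) (hd ys) (tl ys)"

text \<open>
  The term \<open>(y\<^sub>1 \<and> \<dots> \<and> y\<^sub>k) \<setminus> (y\<^sub>k\<^sub>+\<^sub>1 \<or> \<dots> \<or> y\<^sub>n)\<close>, where \<open>ys\<close> lists \<open>y\<^sub>1, \<dots>, y\<^sub>n\<close>.
\<close>

definition atomic_term_value :: "'a skew_alg \<Rightarrow> nat \<Rightarrow> 'a list \<Rightarrow> 'a" where
  "atomic_term_value S k ys =
     (if k = length ys then list_meet S ys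
      else list_meet S (take k ys) \<setminus>\<^bsub>S\<^esub> list_join S (drop k ys))"

text \<open>
  All values of the atomic terms at the distinct elements of a finite set \<open>F\<close>.  Terms that
  are identified in the left- or right-handed case have equal values there, so that at most
  \<open>n * 2 ^ (n - 1)\<close> values can occur, where \<open>n = card F\<close>.
\<close>

definition atomic_outcomes :: "'a skew_alg \<Rightarrow> 'a set \<Rightarrow> 'a set" where
  "atomic_outcomes S F =
     {atomic_term_value S k ys | k ys. ys \<in> permutations_of_set F \<and> 1 \<le> k \<and> k \<le> card F}"

end

theory Submission
  imports Defs
begin

text \<open>
  Let \<open>S\<close> be left-handed.  Every \<open>e\<close> is the join of \<open>e \<sqinter> y\<close> and \<open>e \<setminus> y\<close>, and for fixed \<open>y\<close> both
  \<open>e \<mapsto> e \<sqinter> y\<close> and \<open>e \<mapsto> e \<setminus> y\<close> are idempotent endomorphisms of \<open>S\<close>; all these endomorphisms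
  commute.  For a finite family of elements and a subset \<open>Z\<close> of it, meet with the members of \<open>Z\<close>
  and subtract the others.  The resulting endomorphisms, the cuts, are jointly injective when
  \<open>Z\<close> varies (\<open>eq_if_all_cuts_eq\<close>).  The cut along \<open>Z\<close> sends the members outside \<open>Z\<close> to zero and
  the members of \<open>Z\<close> into one \<open>\<D>\<close>-class, where \<open>a \<sqinter> b = a\<close>, \<open>a \<squnion> b = b\<close> and \<open>a \<setminus> b = \<zero>\<close>; so it
  sends every element generated by the family to zero or to the cut of a member of \<open>Z\<close>.  The cut of
  \<open>u \<in> Z\<close> along \<open>Z\<close> is the value of the atomic term with first variable \<open>u\<close> and positive variables \<open>Z\<close>.

  The theorem follows by comparing each condition with \<open>atoms_separated\<close>: for all finitely many
  generators, the cuts along \<open>Z\<close> of the members of \<open>Z\<close> are nonzero and distinct.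

  \<^item> Values of atomic terms with different sets \<open>Z\<close> are orthogonal, hence distinct once they are
    nonzero.  Thus (iii), a counting condition, says that the atoms are separated.

  \<^item> Let the atoms be separated and let \<open>f\<close> map the generators into \<open>B\<close>.  In the subalgebra of
    \<open>S \<times> B\<close> generated by the graph of \<open>f\<close>, the cut of a pair along \<open>Z\<close> is zero or the cut of
    some \<open>(u, f u)\<close> with \<open>u \<in> Z\<close>, so its first component determines the second.  As cuts are
    jointly injective in \<open>B\<close>, the subalgebra is the graph of a homomorphism extending \<open>f\<close>.
    Conversely, homomorphisms from a free algebra to a primitive algebra with two nonzero elements
    tell the atoms apart.

  \<^item> Condition (ii) is a separation condition for the finite sets of generators one by one, and
    separation for \<open>X\<close> involves only finitely many generators at a time.

  \<^item> If the atoms are separated, the homomorphisms from \<open>S\<close> to generalized Boolean algebras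
    factor through \<open>S/\<D>\<close>, and a common lower bound of two generators has all its cuts zero.
    Conversely, homomorphisms from a free \<open>S/\<D>\<close> to the two-element algebra show that the atoms are
    nonzero, and if \<open>u\<close> and \<open>v\<close> had the same cut along \<open>Z\<close>, that cut would be a nonzero common
    lower bound of them.

  Reversing \<open>\<sqinter>\<close> and \<open>\<squnion>\<close> exchanges the two kinds of handedness and preserves each of the conditions,
  which settles the right-handed case.
\<close>


section \<open>Calculus in a left-handed skew Boolean algebra\<close>

context skew_boolean_algebra
begin

declare meet_closed [simp, intro] join_closed [simp, intro] diff_closed [simp, intro]
  zero_closed [simp, intro] zero_meet [simp] meet_zero [simp] zero_join [simp] join_zero [simp]

lemma meet_idem [simp]: "x \<in> carrier S \<Longrightarrow> x \<sqinter> x = x"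
  using meet_join_absorb[of x "x \<sqinter> x"] join_absorb_meet[of x x] by simp

text \<open>
  Expanding \<open>(x \<squnion> y) \<sqinter> (y \<squnion> x)\<close> by one distributive law first and by the other first gives the
  two sides.
\<close>

lemma orthogonal_join_commute:
  assumes c: "x \<in> carrier S" "y \<in> carrier S" and z: "x \<sqinter> y = \<zero>" "y \<sqinter> x = \<zero>"
  shows "x \<squnion> y = y \<squnion> x"
proof -
  have "(x \<squnion> y) \<sqinter> (y \<squnion> x) = y \<squnion> x"
    using c z distrib_left[of "x \<squnion> y" y x] distrib_right[of x y x] distrib_right[of x y y]
    by simp
  moreover have "(x \<squnion> y) \<sqinter> (y \<squnion> x) = x \<squnion> y"
    using c z distrib_right[of x y "y \<squnion> x"] distrib_left[of x y x] distrib_left[of y y x]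
    by simp
  ultimately show ?thesis by simp
qed

end

context left_handed_sba
begin

lemma meet_absorb_repeat:
  "\<lbrakk>x \<in> carrier S; y \<in> carrier S\<rbrakk> \<Longrightarrow> x \<sqinter> (y \<sqinter> x) = x \<sqinter> y"
  using left_meet[of x y] meet_assoc[of x y x] by simp

lemma meet_left_idem:
  "\<lbrakk>x \<in> carrier S; y \<in> carrier S\<rbrakk> \<Longrightarrow> x \<sqinter> (x \<sqinter> y) = x \<sqinter> y"
  using meet_assoc[of x x y] by simp

lemma meet_join_absorb_left:
  assumes "x \<in> carrier S" "y \<in> carrier S"
  shows "(x \<sqinter> y) \<squnion> x = x"
  using meet_absorb_join[of x "x \<sqinter> y"] assms by (simp add: left_meet)

lemma meet_eq_zero_commute:
  assumes "x \<in> carrier S" "y \<in> carrier S" "x \<sqinter> y = \<zero>"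
  shows "y \<sqinter> x = \<zero>"
proof -
  have "y \<sqinter> x = (y \<sqinter> x) \<sqinter> y" using left_meet assms(1,2) by simp
  also have "\<dots> = y \<sqinter> (x \<sqinter> y)" using meet_assoc assms(1,2) by simp
  finally show ?thesis using assms by simp
qed

lemma meet_diff_zero:
  assumes "x \<in> carrier S" "y \<in> carrier S"
  shows "(x \<sqinter> y) \<sqinter> (x \<setminus> y) = \<zero>" "(x \<setminus> y) \<sqinter> (x \<sqinter> y) = \<zero>" "(x \<sqinter> y) \<squnion> (x \<setminus> y) = x"
  using meet_meet_diff[of x y] diff_meet_meet[of x y] meet_join_diff[of x y] left_meet[of x y] assms
  by simp_all

lemma meet_diff_self:
  assumes "x \<in> carrier S" "y \<in> carrier S"
  shows "x \<sqinter> (x \<setminus> y) = x \<setminus> y" "(x \<setminus> y) \<sqinter> x = x \<setminus> y"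
proof -
  show "x \<sqinter> (x \<setminus> y) = x \<setminus> y"
    using join_meet_absorb[of "x \<setminus> y" "x \<sqinter> y"] assms by (simp add: meet_diff_zero)
  show "(x \<setminus> y) \<sqinter> x = x \<setminus> y"
    using distrib_left[of "x \<setminus> y" "x \<sqinter> y" "x \<setminus> y"] assms by (simp add: meet_diff_zero)
qed

lemma diff_meet_zero:
  assumes "x \<in> carrier S" "y \<in> carrier S"
  shows "(x \<setminus> y) \<sqinter> y = \<zero>" "y \<sqinter> (x \<setminus> y) = \<zero>"
proof -
  have "(x \<setminus> y) \<sqinter> y = ((x \<setminus> y) \<sqinter> x) \<sqinter> y" using assms by (simp add: meet_diff_self)
  also have "\<dots> = \<zero>" using assms meet_assoc[of "x \<setminus> y" x y] by (simp add: meet_diff_zero)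
  finally show *: "(x \<setminus> y) \<sqinter> y = \<zero>" .
  show "y \<sqinter> (x \<setminus> y) = \<zero>" by (rule meet_eq_zero_commute[OF _ _ *]) (use assms in auto)
qed

text \<open>
  Two elements below \<open>x\<close> that lie in one \<open>\<D>\<close>-class are equal: writing \<open>x\<close> as the join of \<open>b\<close>
  and its complement in \<open>x\<close> and meeting with \<open>a\<close>, the second summand vanishes.
\<close>

lemma D_class_below_unique:
  assumes c: "x \<in> carrier S" "a \<in> carrier S" "b \<in> carrier S"
    and "x \<sqinter> a = a" "x \<sqinter> b = b" and ab: "a \<sqinter> b = a" "b \<sqinter> a = b"
  shows "a = b"
proof -
  define d where "d = x \<setminus> b"
  have [simp]: "d \<in> carrier S" by (simp add: d_def c)
  have x: "x = b \<squnion> d" using meet_diff_zero(3)[of x b] assms by (simp add: d_def)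
  have "d \<sqinter> a = (d \<sqinter> a) \<sqinter> d" using c by (simp add: left_meet)
  also have "\<dots> = (d \<sqinter> (a \<sqinter> b)) \<sqinter> d" by (simp add: ab)
  also have "\<dots> = (d \<sqinter> a) \<sqinter> (b \<sqinter> d)" using c by (simp add: meet_assoc)
  also have "b \<sqinter> d = \<zero>" using diff_meet_zero(2)[of x b] c by (simp add: d_def)
  finally have "d \<sqinter> a = \<zero>" using c by simp
  then have "(b \<squnion> d) \<sqinter> a = b" using c distrib_right[of b d a] ab by simp
  then show ?thesis using x assms by simp
qed

text \<open>
  Meets below a fixed element commute: \<open>x \<sqinter> (y \<sqinter> z)\<close> and \<open>x \<sqinter> (z \<sqinter> y)\<close> lie below \<open>x\<close> and in the same
  \<open>\<D>\<close>-class.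
\<close>

lemma meet_normal:
  assumes c: "x \<in> carrier S" "y \<in> carrier S" "z \<in> carrier S"
  shows "x \<sqinter> (y \<sqinter> z) = x \<sqinter> (z \<sqinter> y)"
proof (rule D_class_below_unique[of x])
  have *: "(x \<sqinter> (y \<sqinter> z)) \<sqinter> (x \<sqinter> (z \<sqinter> y)) = x \<sqinter> (y \<sqinter> z)"
    if c: "x \<in> carrier S" "y \<in> carrier S" "z \<in> carrier S" for x y z
  proof -
    have "(x \<sqinter> (y \<sqinter> z)) \<sqinter> (x \<sqinter> (z \<sqinter> y)) = ((x \<sqinter> (y \<sqinter> z)) \<sqinter> x) \<sqinter> (z \<sqinter> y)"
      using c by (simp add: meet_assoc)
    also have "\<dots> = (x \<sqinter> (y \<sqinter> z)) \<sqinter> (z \<sqinter> y)" using c by (simp add: left_meet)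
    also have "\<dots> = x \<sqinter> ((y \<sqinter> (z \<sqinter> z)) \<sqinter> y)" using c by (simp add: meet_assoc meet_left_idem)
    finally show ?thesis using c by (simp add: left_meet)
  qed
  show "(x \<sqinter> (y \<sqinter> z)) \<sqinter> (x \<sqinter> (z \<sqinter> y)) = x \<sqinter> (y \<sqinter> z)"
    "(x \<sqinter> (z \<sqinter> y)) \<sqinter> (x \<sqinter> (y \<sqinter> z)) = x \<sqinter> (z \<sqinter> y)"
    using * c by blast+
qed (use c in \<open>auto simp: meet_left_idem\<close>)

lemma meet_normal4:
  assumes "x \<in> carrier S" "y \<in> carrier S" "z \<in> carrier S" "w \<in> carrier S"
  shows "x \<sqinter> (y \<sqinter> (z \<sqinter> w)) = x \<sqinter> (z \<sqinter> (y \<sqinter> w))"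
proof -
  have "x \<sqinter> (y \<sqinter> (z \<sqinter> w)) = (x \<sqinter> (y \<sqinter> z)) \<sqinter> w" using assms by (simp add: meet_assoc)
  also have "\<dots> = (x \<sqinter> (z \<sqinter> y)) \<sqinter> w" using assms meet_normal[of x y z] by simp
  finally show ?thesis using assms by (simp add: meet_assoc)
qed

lemmas meet_nf = meet_assoc meet_normal meet_normal4 meet_left_idem meet_absorb_repeat

lemma meet_right_commute:
  assumes "x \<in> carrier S" "y \<in> carrier S" "z \<in> carrier S"
  shows "(x \<sqinter> y) \<sqinter> z = (x \<sqinter> z) \<sqinter> y"
  using assms by (simp add: meet_nf)

text \<open>
  Relative complements are unique, by the usual argument for distributive lattices.  The operation
  \<open>\<setminus>\<close> is therefore determined by its axioms, and identities about it can be proved by checking that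
  both sides are complements.
\<close>

lemma complement_unique:
  assumes c: "p \<in> carrier S" "d \<in> carrier S" "d' \<in> carrier S"
    and "p \<squnion> d = p \<squnion> d'" and "p \<sqinter> d = \<zero>" "p \<sqinter> d' = \<zero>"
  shows "d = d'"
proof -
  have dp: "d \<sqinter> p = \<zero>" and dp': "d' \<sqinter> p = \<zero>" using meet_eq_zero_commute assms by blast+
  have "d \<sqinter> (p \<squnion> d) = d" "d' \<sqinter> (p \<squnion> d) = d' \<sqinter> d" "d \<sqinter> (p \<squnion> d') = d \<sqinter> d'"
    using c dp dp' by (simp_all add: distrib_left)
  then have 1: "d \<sqinter> d' = d" using assms(4) by simp
  have "(p \<squnion> d) \<sqinter> d' = d \<sqinter> d'" "(p \<squnion> d') \<sqinter> d' = d'"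
    using c assms(5,6) by (simp_all add: distrib_right)
  then show ?thesis using 1 assms(4) by metis
qed

lemma diff_eqI:
  assumes "x \<in> carrier S" "y \<in> carrier S" "d \<in> carrier S"
    and "(x \<sqinter> y) \<squnion> d = x" "(x \<sqinter> y) \<sqinter> d = \<zero>"
  shows "x \<setminus> y = d"
  by (rule complement_unique[of "x \<sqinter> y"]) (use assms in \<open>auto simp: meet_diff_zero\<close>)

lemma zero_diff [simp]: "x \<in> carrier S \<Longrightarrow> \<zero> \<setminus> x = \<zero>"
  by (rule diff_eqI) auto

lemma diff_zero [simp]: "x \<in> carrier S \<Longrightarrow> x \<setminus> \<zero> = x"
  by (rule diff_eqI) auto

lemma diff_eq_zero:
  assumes "x \<in> carrier S" "y \<in> carrier S" "x \<sqinter> y = x"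
  shows "x \<setminus> y = \<zero>"
  by (rule diff_eqI) (use assms in auto)

lemma join_eq_right:
  assumes "x \<in> carrier S" "y \<in> carrier S" "x \<sqinter> y = x"
  shows "x \<squnion> y = y"
  using meet_absorb_join[of y x] assms by simp

text \<open>
  The next lemmas show that \<open>e \<mapsto> e \<sqinter> b\<close> and \<open>e \<mapsto> e \<setminus> b\<close> are endomorphisms (for joins under the
  first map this is right distributivity) and that a map of the second kind commutes with those of
  either kind.
\<close>

lemma meet_meet_distrib:
  assumes "x \<in> carrier S" "y \<in> carrier S" "b \<in> carrier S"
  shows "(x \<sqinter> y) \<sqinter> b = (x \<sqinter> b) \<sqinter> (y \<sqinter> b)"
  using assms by (simp add: meet_nf)

lemma meet_diff_distrib:
  assumes "x \<in> carrier S" "y \<in> carrier S" "b \<in> carrier S"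
  shows "(x \<setminus> y) \<sqinter> b = (x \<sqinter> b) \<setminus> (y \<sqinter> b)"
proof (rule diff_eqI[symmetric])
  have p: "(x \<sqinter> b) \<sqinter> (y \<sqinter> b) = (x \<sqinter> y) \<sqinter> b" using assms by (rule meet_meet_distrib[symmetric])
  show "((x \<sqinter> b) \<sqinter> (y \<sqinter> b)) \<squnion> ((x \<setminus> y) \<sqinter> b) = x \<sqinter> b"
    unfolding p using assms distrib_right[of "x \<sqinter> y" "x \<setminus> y" b, symmetric] by (simp add: meet_diff_zero)
  show "((x \<sqinter> b) \<sqinter> (y \<sqinter> b)) \<sqinter> ((x \<setminus> y) \<sqinter> b) = \<zero>"
    unfolding p using assms meet_meet_distrib[of "x \<sqinter> y" "x \<setminus> y" b] by (simp add: meet_diff_zero)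
qed (use assms in auto)

lemma diff_meet_zero3:
  assumes "x \<in> carrier S" "y \<in> carrier S" "b \<in> carrier S"
  shows "(x \<setminus> b) \<sqinter> (y \<sqinter> b) = \<zero>" "(x \<sqinter> b) \<sqinter> (y \<setminus> b) = \<zero>"
proof -
  have "(x \<setminus> b) \<sqinter> (y \<sqinter> b) = ((x \<setminus> b) \<sqinter> b) \<sqinter> y"
    using assms meet_assoc[of "x \<setminus> b" b y] meet_normal[of "x \<setminus> b" b y] by simp
  then show "(x \<setminus> b) \<sqinter> (y \<sqinter> b) = \<zero>" using assms by (simp add: diff_meet_zero)
  have "(x \<sqinter> b) \<sqinter> (y \<setminus> b) = x \<sqinter> (b \<sqinter> (y \<setminus> b))" using assms by (simp add: meet_assoc)
  then show "(x \<sqinter> b) \<sqinter> (y \<setminus> b) = \<zero>" using assms by (simp add: diff_meet_zero)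
qed

lemma diff_meet_eq:
  assumes "x \<in> carrier S" "y \<in> carrier S" "b \<in> carrier S"
  shows "(x \<setminus> b) \<sqinter> y = (x \<setminus> b) \<sqinter> (y \<setminus> b)"
  using assms distrib_left[of "x \<setminus> b" "y \<sqinter> b" "y \<setminus> b"] by (simp add: meet_diff_zero diff_meet_zero3)

lemma diff_meet_distrib:
  assumes "x \<in> carrier S" "y \<in> carrier S" "b \<in> carrier S"
  shows "(x \<sqinter> y) \<setminus> b = (x \<setminus> b) \<sqinter> (y \<setminus> b)"
proof (rule diff_eqI)
  have xy: "((x \<sqinter> b) \<squnion> (x \<setminus> b)) \<sqinter> y = x \<sqinter> y" using assms by (simp add: meet_diff_zero)
  have "((x \<sqinter> y) \<sqinter> b) \<squnion> ((x \<setminus> b) \<sqinter> (y \<setminus> b)) = ((x \<sqinter> b) \<sqinter> y) \<squnion> ((x \<setminus> b) \<sqinter> y)"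
    using assms meet_right_commute[of x y b] diff_meet_eq[of x y b] by simp
  also have "\<dots> = x \<sqinter> y" using assms xy by (simp add: distrib_right)
  finally show "((x \<sqinter> y) \<sqinter> b) \<squnion> ((x \<setminus> b) \<sqinter> (y \<setminus> b)) = x \<sqinter> y" .
  have "((x \<sqinter> y) \<sqinter> b) \<sqinter> ((x \<setminus> b) \<sqinter> (y \<setminus> b)) = (((x \<sqinter> y) \<sqinter> b) \<sqinter> (x \<setminus> b)) \<sqinter> (y \<setminus> b)"
    using assms meet_assoc[of "(x \<sqinter> y) \<sqinter> b" "x \<setminus> b" "y \<setminus> b"] by simp
  then show "((x \<sqinter> y) \<sqinter> b) \<sqinter> ((x \<setminus> b) \<sqinter> (y \<setminus> b)) = \<zero>"
    using assms diff_meet_zero3(2)[of "x \<sqinter> y" x b] by simp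
qed (use assms in auto)

lemma diff_join_distrib:
  assumes "x \<in> carrier S" "y \<in> carrier S" "b \<in> carrier S"
  shows "(x \<squnion> y) \<setminus> b = (x \<setminus> b) \<squnion> (y \<setminus> b)"
proof (rule diff_eqI)
  have comm: "(y \<sqinter> b) \<squnion> (x \<setminus> b) = (x \<setminus> b) \<squnion> (y \<sqinter> b)"
    by (rule orthogonal_join_commute) (use assms in \<open>auto simp: diff_meet_zero3\<close>)
  have "((x \<squnion> y) \<sqinter> b) \<squnion> ((x \<setminus> b) \<squnion> (y \<setminus> b))
      = (x \<sqinter> b) \<squnion> (((y \<sqinter> b) \<squnion> (x \<setminus> b)) \<squnion> (y \<setminus> b))"
    using assms by (simp add: distrib_right join_assoc)
  also have "\<dots> = ((x \<sqinter> b) \<squnion> (x \<setminus> b)) \<squnion> ((y \<sqinter> b) \<squnion> (y \<setminus> b))"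
    unfolding comm using assms by (simp only: join_assoc join_closed meet_closed diff_closed)
  finally show "((x \<squnion> y) \<sqinter> b) \<squnion> ((x \<setminus> b) \<squnion> (y \<setminus> b)) = x \<squnion> y"
    using assms by (simp add: meet_diff_zero)
  show "((x \<squnion> y) \<sqinter> b) \<sqinter> ((x \<setminus> b) \<squnion> (y \<setminus> b)) = \<zero>"
    using assms by (simp add: distrib_left diff_meet_zero3)
qed (use assms in auto)

lemma diff_diff_distrib:
  assumes "x \<in> carrier S" "y \<in> carrier S" "b \<in> carrier S"
  shows "(x \<setminus> y) \<setminus> b = (x \<setminus> b) \<setminus> (y \<setminus> b)"
proof (rule diff_eqI[symmetric])
  show "((x \<setminus> b) \<sqinter> (y \<setminus> b)) \<squnion> ((x \<setminus> y) \<setminus> b) = x \<setminus> b"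
    using assms diff_join_distrib[of "x \<sqinter> y" "x \<setminus> y" b, symmetric]
    by (simp add: diff_meet_distrib meet_diff_zero)
  show "((x \<setminus> b) \<sqinter> (y \<setminus> b)) \<sqinter> ((x \<setminus> y) \<setminus> b) = \<zero>"
    using assms diff_meet_distrib[of "x \<sqinter> y" "x \<setminus> y" b]
    by (simp add: diff_meet_distrib meet_diff_zero)
qed (use assms in auto)

lemma diff_meet_commute:
  assumes "x \<in> carrier S" "y \<in> carrier S" "b \<in> carrier S"
  shows "(x \<sqinter> y) \<setminus> b = (x \<setminus> b) \<sqinter> y"
  using assms diff_meet_distrib[of x y b] diff_meet_eq[of x y b] by simp

lemma diff_right_commute:
  assumes "x \<in> carrier S" "y \<in> carrier S" "b \<in> carrier S"
  shows "(x \<setminus> y) \<setminus> b = (x \<setminus> b) \<setminus> y"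
proof -
  have "(x \<setminus> b) \<setminus> y = (x \<setminus> b) \<setminus> (y \<setminus> b)"
    by (rule diff_eqI)
      (use assms meet_diff_zero[of "x \<setminus> b" "y \<setminus> b"] in \<open>simp_all add: diff_meet_eq[of x y b]\<close>)
  then show ?thesis using assms by (simp only: diff_diff_distrib[of x y b])
qed

lemma diff_diff_idem [simp]:
  assumes "x \<in> carrier S" "y \<in> carrier S"
  shows "(x \<setminus> y) \<setminus> y = x \<setminus> y"
  by (rule diff_eqI) (use assms in \<open>auto simp: diff_meet_zero\<close>)

lemma diff_join_eq_diff_diff:
  assumes "x \<in> carrier S" "y \<in> carrier S" "z \<in> carrier S"
  shows "x \<setminus> (y \<squnion> z) = (x \<setminus> y) \<setminus> z"
proof (rule diff_eqI)
  have "x \<sqinter> z = ((x \<sqinter> y) \<squnion> (x \<setminus> y)) \<sqinter> z" using assms by (simp add: meet_diff_zero)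
  also have "\<dots> = ((x \<sqinter> y) \<sqinter> z) \<squnion> ((x \<setminus> y) \<sqinter> z)" using assms by (simp add: distrib_right)
  finally have "(x \<sqinter> y) \<squnion> (x \<sqinter> z) = ((x \<sqinter> y) \<squnion> ((x \<sqinter> y) \<sqinter> z)) \<squnion> ((x \<setminus> y) \<sqinter> z)"
    using assms by (simp only: join_assoc join_closed meet_closed diff_closed)
  also have "\<dots> = (x \<sqinter> y) \<squnion> ((x \<setminus> y) \<sqinter> z)"
    using assms join_absorb_meet[of "x \<sqinter> y" z] by simp
  finally have p: "x \<sqinter> (y \<squnion> z) = (x \<sqinter> y) \<squnion> ((x \<setminus> y) \<sqinter> z)"
    using assms by (simp add: distrib_left)
  show "(x \<sqinter> (y \<squnion> z)) \<squnion> ((x \<setminus> y) \<setminus> z) = x"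
    unfolding p using assms meet_diff_zero(3)[of "x \<setminus> y" z] meet_diff_zero(3)[of x y]
    by (simp add: join_assoc)
  have "(x \<sqinter> y) \<sqinter> ((x \<setminus> y) \<setminus> z) = \<zero>"
    using assms diff_meet_zero3(2)[of x "x \<setminus> z" y] diff_right_commute[of x y z] by simp
  then show "(x \<sqinter> (y \<squnion> z)) \<sqinter> ((x \<setminus> y) \<setminus> z) = \<zero>"
    unfolding p using assms by (simp add: distrib_right diff_meet_zero3)
qed (use assms in auto)

end


section \<open>Homomorphisms\<close>

lemma in_sba_homI:
  assumes "\<And>x. x \<in> carrier A \<Longrightarrow> h x \<in> carrier B" "h \<zero>\<^bsub>A\<^esub> = \<zero>\<^bsub>B\<^esub>"
    and "\<And>x y. \<lbrakk>x \<in> carrier A; y \<in> carrier A\<rbrakk> \<Longrightarrow> h (x \<sqinter>\<^bsub>A\<^esub> y) = h x \<sqinter>\<^bsub>B\<^esub> h y"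
    and "\<And>x y. \<lbrakk>x \<in> carrier A; y \<in> carrier A\<rbrakk> \<Longrightarrow> h (x \<squnion>\<^bsub>A\<^esub> y) = h x \<squnion>\<^bsub>B\<^esub> h y"
    and "\<And>x y. \<lbrakk>x \<in> carrier A; y \<in> carrier A\<rbrakk> \<Longrightarrow> h (x \<setminus>\<^bsub>A\<^esub> y) = h x \<setminus>\<^bsub>B\<^esub> h y"
  shows "h \<in> sba_hom A B"
  using assms by (auto simp: sba_hom_def)

lemma sba_homD:
  assumes "h \<in> sba_hom A B"
  shows "x \<in> carrier A \<Longrightarrow> h x \<in> carrier B" "h \<zero>\<^bsub>A\<^esub> = \<zero>\<^bsub>B\<^esub>"
    and "\<lbrakk>x \<in> carrier A; y \<in> carrier A\<rbrakk> \<Longrightarrow> h (x \<sqinter>\<^bsub>A\<^esub> y) = h x \<sqinter>\<^bsub>B\<^esub> h y"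
    and "\<lbrakk>x \<in> carrier A; y \<in> carrier A\<rbrakk> \<Longrightarrow> h (x \<squnion>\<^bsub>A\<^esub> y) = h x \<squnion>\<^bsub>B\<^esub> h y"
    and "\<lbrakk>x \<in> carrier A; y \<in> carrier A\<rbrakk> \<Longrightarrow> h (x \<setminus>\<^bsub>A\<^esub> y) = h x \<setminus>\<^bsub>B\<^esub> h y"
  using assms by (auto simp: sba_hom_def)

lemma sba_hom_comp: "\<lbrakk>h \<in> sba_hom A B; k \<in> sba_hom B C\<rbrakk> \<Longrightarrow> k \<circ> h \<in> sba_hom A C"
  by (auto simp: sba_hom_def Pi_iff)

lemma (in skew_boolean_algebra) generated_subset_carrier:
  assumes "X \<subseteq> carrier S"
  shows "generated S X \<subseteq> carrier S"
proof
  fix x assume "x \<in> generated S X"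
  then show "x \<in> carrier S"
    by induction (use assms in \<open>auto intro: meet_closed join_closed diff_closed zero_closed\<close>)
qed

lemma sba_hom_unique:
  assumes gen: "generated A X = carrier A"
    and h: "h \<in> sba_hom A B" "h \<in> extensional (carrier A)"
    and k: "k \<in> sba_hom A B" "k \<in> extensional (carrier A)"
    and eq: "\<And>x. x \<in> X \<Longrightarrow> h x = k x"
  shows "h = k"
proof (rule extensionalityI[OF h(2) k(2)])
  fix a assume "a \<in> carrier A"
  then have "a \<in> generated A X" by (simp add: gen)
  then show "h a = k a"
    by induction (simp_all add: eq sba_homD[OF h(1)] sba_homD[OF k(1)] gen)
qed


section \<open>Splitting along finitely many elements\<close>

text \<open>
  An element \<open>e\<close> is split along \<open>g y\<close> into the part meeting \<open>g y\<close> and the part off it; \<open>Z\<close> is the set of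
  indices for which the former is kept.
\<close>

definition split_step :: "'a skew_alg \<Rightarrow> ('c \<Rightarrow> 'a) \<Rightarrow> 'c set \<Rightarrow> 'c \<Rightarrow> 'a \<Rightarrow> 'a" where
  "split_step B g Z y e = (if y \<in> Z then e \<sqinter>\<^bsub>B\<^esub> g y else e \<setminus>\<^bsub>B\<^esub> g y)"

definition cut :: "'a skew_alg \<Rightarrow> ('c \<Rightarrow> 'a) \<Rightarrow> 'c set \<Rightarrow> 'c list \<Rightarrow> 'a \<Rightarrow> 'a" where
  "cut B g Z ys e = fold (split_step B g Z) ys e"

lemma cut_Nil [simp]: "cut B g Z [] e = e"
  and cut_Cons [simp]: "cut B g Z (y # ys) e = cut B g Z ys (split_step B g Z y e)"
  and cut_append: "cut B g Z (ys @ zs) e = cut B g Z zs (cut B g Z ys e)"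
  by (simp_all add: cut_def)

lemma cut_cong:
  "(\<And>y. y \<in> set ys \<Longrightarrow> y \<in> Z \<longleftrightarrow> y \<in> Z') \<Longrightarrow> cut B g Z ys e = cut B g Z' ys e"
  by (induction ys arbitrary: e) (auto simp: split_step_def)

context left_handed_sba
begin

lemma split_step_hom:
  assumes "g y \<in> carrier S"
  shows "split_step S g Z y \<in> sba_hom S S"
proof (cases "y \<in> Z")
  case True
  then have "split_step S g Z y = (\<lambda>e. e \<sqinter> g y)" by (simp add: split_step_def fun_eq_iff)
  then show ?thesis
    using assms by (intro in_sba_homI) (simp_all add: distrib_right meet_meet_distrib[symmetric] meet_diff_distrib)
next
  case False
  then have "split_step S g Z y = (\<lambda>e. e \<setminus> g y)" by (simp add: split_step_def fun_eq_iff)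
  then show ?thesis
    using assms by (intro in_sba_homI)
      (simp_all add: diff_join_distrib diff_meet_distrib diff_diff_distrib[symmetric])
qed

lemma split_step_closed [simp]:
  "\<lbrakk>g y \<in> carrier S; e \<in> carrier S\<rbrakk> \<Longrightarrow> split_step S g Z y e \<in> carrier S"
  by (simp add: split_step_def)

lemma cut_hom:
  assumes "\<And>y. y \<in> set ys \<Longrightarrow> g y \<in> carrier S"
  shows "cut S g Z ys \<in> sba_hom S S"
  using assms
proof (induction ys)
  case Nil
  then show ?case by (simp add: sba_hom_def)
next
  case (Cons y ys)
  have "cut S g Z (y # ys) = cut S g Z ys \<circ> split_step S g Z y" by (simp add: fun_eq_iff)
  moreover have "cut S g Z ys \<circ> split_step S g Z y \<in> sba_hom S S"
    by (rule sba_hom_comp[OF split_step_hom Cons.IH]) (use Cons.prems in auto)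
  ultimately show ?case by (simp only:)
qed

lemma cut_closed [simp]:
  "\<lbrakk>\<And>y. y \<in> set ys \<Longrightarrow> g y \<in> carrier S; e \<in> carrier S\<rbrakk> \<Longrightarrow> cut S g Z ys e \<in> carrier S"
  by (rule sba_homD(1)[OF cut_hom])

lemma split_step_idem:
  assumes "g y \<in> carrier S" "e \<in> carrier S"
  shows "split_step S g Z y (split_step S g Z y e) = split_step S g Z y e"
  using assms by (simp add: split_step_def meet_assoc)

lemma split_step_commute:
  assumes "g x \<in> carrier S" "g y \<in> carrier S" "e \<in> carrier S"
  shows "split_step S g Z x (split_step S g Z y e) = split_step S g Z y (split_step S g Z x e)"
  using assms diff_meet_commute[of e "g x" "g y"] diff_meet_commute[of e "g y" "g x"]
  by (cases "x \<in> Z"; cases "y \<in> Z")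
    (simp_all add: split_step_def meet_right_commute[of e "g x" "g y"] diff_right_commute[of e "g x" "g y"])

lemma split_step_cut:
  assumes "\<And>y. y \<in> set ys \<Longrightarrow> g y \<in> carrier S" "g x \<in> carrier S" "e \<in> carrier S"
  shows "split_step S g Z x (cut S g Z ys e) = cut S g Z ys (split_step S g Z x e)"
  using assms by (induction ys arbitrary: e) (simp_all add: split_step_commute)

text \<open>
  Steps commute and are idempotent, so a step that occurs in a cut can be added at no cost, before
  the cut or (\<open>step_absorb_cut\<close>) after it.
\<close>

lemma cut_absorb_step:
  assumes "\<And>y. y \<in> set ys \<Longrightarrow> g y \<in> carrier S" "x \<in> set ys" "e \<in> carrier S"
  shows "cut S g Z ys (split_step S g Z x e) = cut S g Z ys e"
  using assms
proof (induction ys arbitrary: e)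
  case (Cons y ys)
  show ?case
  proof (cases "x = y")
    case True
    then show ?thesis using Cons.prems by (simp add: split_step_idem)
  next
    case False
    then show ?thesis using Cons by (simp add: split_step_commute[of g y x])
  qed
qed simp

lemma step_absorb_cut:
  assumes "\<And>y. y \<in> set ys \<Longrightarrow> g y \<in> carrier S" "x \<in> set ys" "e \<in> carrier S"
  shows "split_step S g Z x (cut S g Z ys e) = cut S g Z ys e"
  using assms by (simp add: split_step_cut cut_absorb_step)

text \<open>
  Order and repetitions in the list are immaterial: each of the two cuts absorbs all steps of the
  other, so both equal their composition.
\<close>

lemma cut_cong_set:
  assumes g: "\<And>y. y \<in> set ys \<Longrightarrow> g y \<in> carrier S" and eq: "set ys = set zs" and e: "e \<in> carrier S"
  shows "cut S g Z ys e = cut S g Z zs e"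
proof -
  have 1: "cut S g Z ys (cut S g Z ws e) = cut S g Z ys e"
    if "set ws \<subseteq> set ys" for ws using that e
    by (induction ws arbitrary: e) (simp_all add: g cut_absorb_step)
  have 2: "cut S g Z ws (cut S g Z zs e) = cut S g Z zs e"
    if "set ws \<subseteq> set zs" for ws using that
    by (induction ws) (use e g eq in \<open>simp_all add: step_absorb_cut\<close>)
  show ?thesis using 1[of zs] 2[of ys] eq by simp
qed

text \<open>
  Splitting off \<open>g y\<close> loses nothing, as \<open>e\<close> is the join of \<open>e \<sqinter> g y\<close> and \<open>e \<setminus> g y\<close>; so an
  element is determined by all its cuts along a list.
\<close>

lemma eq_if_all_cuts_eq:
  assumes "\<And>y. y \<in> set ys \<Longrightarrow> g y \<in> carrier S" "distinct ys" "a \<in> carrier S" "b \<in> carrier S"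
    and "\<And>Z. Z \<subseteq> set ys \<Longrightarrow> cut S g Z ys a = cut S g Z ys b"
  shows "a = b"
  using assms
proof (induction ys arbitrary: a b)
  case Nil
  then show ?case using Nil.prems(5)[of "{}"] by simp
next
  case (Cons y ys)
  have *: "cut S g Z ys (a \<sqinter> g y) = cut S g Z ys (b \<sqinter> g y)"
    "cut S g Z ys (a \<setminus> g y) = cut S g Z ys (b \<setminus> g y)" if "Z \<subseteq> set ys" for Z
  proof -
    have y: "y \<notin> Z" using that Cons.prems(2) by auto
    have "cut S g (insert y Z) ys e = cut S g Z ys e" for e
      by (rule cut_cong) (use Cons.prems(2) in auto)
    moreover have "insert y Z \<subseteq> set (y # ys)" using that by auto
    from Cons.prems(5)[OF this] have
      "cut S g (insert y Z) ys (a \<sqinter> g y) = cut S g (insert y Z) ys (b \<sqinter> g y)"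
      by (simp add: split_step_def)
    ultimately show "cut S g Z ys (a \<sqinter> g y) = cut S g Z ys (b \<sqinter> g y)" by metis
    have "Z \<subseteq> set (y # ys)" using that by auto
    from Cons.prems(5)[OF this] show "cut S g Z ys (a \<setminus> g y) = cut S g Z ys (b \<setminus> g y)"
      using y by (simp add: split_step_def)
  qed
  have "a \<sqinter> g y = b \<sqinter> g y"
    by (rule Cons.IH[OF _ _ _ _ *(1)]) (use Cons.prems(1-4) in auto)
  moreover have "a \<setminus> g y = b \<setminus> g y"
    by (rule Cons.IH[OF _ _ _ _ *(2)]) (use Cons.prems(1-4) in auto)
  ultimately have "(a \<sqinter> g y) \<squnion> (a \<setminus> g y) = (b \<sqinter> g y) \<squnion> (b \<setminus> g y)" by simp
  then show ?case using Cons.prems(1)[of y] Cons.prems(3,4) by (simp add: meet_diff_zero)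
qed

text \<open>
  The step for \<open>u\<close> fixes the cut, so the cut lies \<open>\<D>\<close>-below \<open>g u\<close> or is orthogonal to it, according
  to whether this step meets with \<open>g u\<close> or subtracts it.
\<close>

lemma cut_meet_generator:
  assumes "\<And>y. y \<in> set ys \<Longrightarrow> g y \<in> carrier S" "u \<in> set ys" "e \<in> carrier S"
  shows "u \<in> Z \<Longrightarrow> cut S g Z ys e \<sqinter> g u = cut S g Z ys e"
    and "u \<in> Z \<Longrightarrow> cut S g Z ys e \<sqinter> cut S g Z ys (g u) = cut S g Z ys e"
    and "u \<notin> Z \<Longrightarrow> cut S g Z ys e \<sqinter> g u = \<zero>"
proof -
  show "cut S g Z ys e \<sqinter> g u = cut S g Z ys e" if "u \<in> Z"
    using step_absorb_cut[of ys g u e Z] assms that by (simp add: split_step_def)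
  show "cut S g Z ys e \<sqinter> cut S g Z ys (g u) = cut S g Z ys e" if "u \<in> Z"
    using cut_absorb_step[of ys g u e Z] sba_homD(3)[OF cut_hom, of ys g e "g u" Z] assms that
    by (simp add: split_step_def)
  show "cut S g Z ys e \<sqinter> g u = \<zero>" if "u \<notin> Z"
    using step_absorb_cut[of ys g u e Z] diff_meet_zero(1)[of "cut S g Z ys e" "g u"] assms that
    by (simp add: split_step_def)
qed

lemma cut_generator_zero:
  assumes "\<And>y. y \<in> set ys \<Longrightarrow> g y \<in> carrier S" "u \<in> set ys" "u \<notin> Z"
  shows "cut S g Z ys (g u) = \<zero>"
  using cut_absorb_step[of ys g u "g u" Z] sba_homD(2)[OF cut_hom, of ys g Z] assms
  by (simp add: split_step_def diff_eq_zero)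

lemma cut_below:
  assumes "\<And>y. y \<in> set ys \<Longrightarrow> g y \<in> carrier S" "e \<in> carrier S"
  shows "nat_le S (cut S g Z ys e) e"
proof -
  have "e \<sqinter> cut S g Z ys e = cut S g Z ys e" using assms
  proof (induction ys arbitrary: e)
    case (Cons y ys)
    let ?e = "split_step S g Z y e" and ?c = "cut S g Z ys (split_step S g Z y e)"
    have "e \<sqinter> ?c = e \<sqinter> (?e \<sqinter> ?c)" using Cons by simp
    also have "\<dots> = (e \<sqinter> ?e) \<sqinter> ?c" using Cons.prems by (simp add: meet_assoc)
    also have "e \<sqinter> ?e = ?e"
      using Cons.prems by (simp add: split_step_def meet_left_idem meet_diff_self)
    finally show ?case using Cons by simp
  qed simp
  moreover from this have "cut S g Z ys e \<sqinter> e = cut S g Z ys e"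
    using assms left_meet[of e "cut S g Z ys e"] by simp
  ultimately show ?thesis by (simp add: nat_le_def)
qed

text \<open>
  The nonzero cuts of generators lie in a single \<open>\<D>\<close>-class, where the operations are trivial.
\<close>

lemma cut_generator_ops:
  assumes "\<And>y. y \<in> set ys \<Longrightarrow> g y \<in> carrier S" "u \<in> Z \<inter> set ys" "v \<in> Z \<inter> set ys"
  shows "cut S g Z ys (g u) \<sqinter> cut S g Z ys (g v) = cut S g Z ys (g u)"
    and "cut S g Z ys (g u) \<squnion> cut S g Z ys (g v) = cut S g Z ys (g v)"
    and "cut S g Z ys (g u) \<setminus> cut S g Z ys (g v) = \<zero>"
proof -
  show "cut S g Z ys (g u) \<sqinter> cut S g Z ys (g v) = cut S g Z ys (g u)"
    using assms by (intro cut_meet_generator(2)) auto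
  then show "cut S g Z ys (g u) \<squnion> cut S g Z ys (g v) = cut S g Z ys (g v)"
    "cut S g Z ys (g u) \<setminus> cut S g Z ys (g v) = \<zero>"
    using assms by (auto intro!: join_eq_right diff_eq_zero)
qed

end

lemma hom_cut:
  assumes "left_handed_sba A" "h \<in> sba_hom A B"
    and "\<And>y. y \<in> set ys \<Longrightarrow> g y \<in> carrier A" "e \<in> carrier A"
  shows "h (cut A g Z ys e) = cut B (h \<circ> g) Z ys (h e)"
proof -
  interpret left_handed_sba A by fact
  show ?thesis using assms(3,4)
    by (induction ys arbitrary: e) (simp_all add: split_step_def sba_homD[OF assms(2)])
qed


section \<open>Extending maps to homomorphisms\<close>

text \<open>
  The possible cuts of the pairs generated by the pairs \<open>(g u, k u)\<close> in the product \<open>A \<times> B\<close>.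
\<close>

definition cut_pairs ::
    "'a skew_alg \<Rightarrow> 'b skew_alg \<Rightarrow> ('c \<Rightarrow> 'a) \<Rightarrow> ('c \<Rightarrow> 'b) \<Rightarrow> 'c set \<Rightarrow> 'c list \<Rightarrow> ('a \<times> 'b) set" where
  "cut_pairs A B g k Z ys = insert (\<zero>\<^bsub>A\<^esub>, \<zero>\<^bsub>B\<^esub>)
     ((\<lambda>u. (cut A g Z ys (g u), cut B k Z ys (k u))) ` (Z \<inter> set ys))"

lemma cut_pairs_closed:
  assumes "left_handed_sba A" "left_handed_sba B"
    and g: "\<And>y. y \<in> set ys \<Longrightarrow> g y \<in> carrier A" and k: "\<And>y. y \<in> set ys \<Longrightarrow> k y \<in> carrier B"
    and p: "(a, b) \<in> cut_pairs A B g k Z ys" "(a', b') \<in> cut_pairs A B g k Z ys"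
  shows "(a \<sqinter>\<^bsub>A\<^esub> a', b \<sqinter>\<^bsub>B\<^esub> b') \<in> cut_pairs A B g k Z ys"
    and "(a \<squnion>\<^bsub>A\<^esub> a', b \<squnion>\<^bsub>B\<^esub> b') \<in> cut_pairs A B g k Z ys"
    and "(a \<setminus>\<^bsub>A\<^esub> a', b \<setminus>\<^bsub>B\<^esub> b') \<in> cut_pairs A B g k Z ys"
proof -
  interpret A: left_handed_sba A by fact
  interpret B: left_handed_sba B by fact
  note [simp] = A.cut_generator_ops[of ys g, OF g] B.cut_generator_ops[of ys k, OF k] g k
  have "a \<in> carrier A" "b \<in> carrier B" "a' \<in> carrier A" "b' \<in> carrier B"
    using p by (auto simp: cut_pairs_def)
  then show "(a \<sqinter>\<^bsub>A\<^esub> a', b \<sqinter>\<^bsub>B\<^esub> b') \<in> cut_pairs A B g k Z ys"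
    "(a \<squnion>\<^bsub>A\<^esub> a', b \<squnion>\<^bsub>B\<^esub> b') \<in> cut_pairs A B g k Z ys"
    "(a \<setminus>\<^bsub>A\<^esub> a', b \<setminus>\<^bsub>B\<^esub> b') \<in> cut_pairs A B g k Z ys"
    using p unfolding cut_pairs_def by auto
qed

lemma cut_pairs_generator:
  assumes "left_handed_sba A" "left_handed_sba B"
    and "\<And>y. y \<in> set ys \<Longrightarrow> g y \<in> carrier A" "\<And>y. y \<in> set ys \<Longrightarrow> k y \<in> carrier B" "u \<in> set ys"
  shows "(cut A g Z ys (g u), cut B k Z ys (k u)) \<in> cut_pairs A B g k Z ys"
  using left_handed_sba.cut_generator_zero[OF assms(1,3,5)]
    left_handed_sba.cut_generator_zero[OF assms(2,4,5)] assms(5)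
  by (cases "u \<in> Z") (auto simp: cut_pairs_def)

text \<open>
  The subalgebra of \<open>A \<times> B\<close> generated by the graph of \<open>f\<close> on \<open>X\<close>, as a relation.
\<close>

inductive generated_graph ::
    "'a skew_alg \<Rightarrow> 'b skew_alg \<Rightarrow> 'a set \<Rightarrow> ('a \<Rightarrow> 'b) \<Rightarrow> 'a \<Rightarrow> 'b \<Rightarrow> bool"
  for A B X f where
  gen: "x \<in> X \<Longrightarrow> generated_graph A B X f x (f x)"
| zero: "generated_graph A B X f \<zero>\<^bsub>A\<^esub> \<zero>\<^bsub>B\<^esub>"
| meet: "\<lbrakk>generated_graph A B X f a b; generated_graph A B X f a' b'\<rbrakk>
    \<Longrightarrow> generated_graph A B X f (a \<sqinter>\<^bsub>A\<^esub> a') (b \<sqinter>\<^bsub>B\<^esub> b')"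
| join: "\<lbrakk>generated_graph A B X f a b; generated_graph A B X f a' b'\<rbrakk>
    \<Longrightarrow> generated_graph A B X f (a \<squnion>\<^bsub>A\<^esub> a') (b \<squnion>\<^bsub>B\<^esub> b')"
| diff: "\<lbrakk>generated_graph A B X f a b; generated_graph A B X f a' b'\<rbrakk>
    \<Longrightarrow> generated_graph A B X f (a \<setminus>\<^bsub>A\<^esub> a') (b \<setminus>\<^bsub>B\<^esub> b')"

lemma generated_graph_total: "a \<in> generated A X \<Longrightarrow> \<exists>b. generated_graph A B X f a b"
  by (induction rule: generated.induct) (blast intro: generated_graph.intros)+

lemma generated_graph_id: "a \<in> generated A X \<Longrightarrow> generated_graph A A X (\<lambda>x. x) a a"
  by (induction rule: generated.induct) (auto intro: generated_graph.intros)

lemma generated_graph_closed: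
  assumes "generated_graph A B X f a b" "skew_boolean_algebra A" "skew_boolean_algebra B"
    and "X \<subseteq> carrier A" "f \<in> X \<rightarrow> carrier B"
  shows "a \<in> carrier A" "b \<in> carrier B"
proof -
  interpret A: skew_boolean_algebra A by fact
  interpret B: skew_boolean_algebra B by fact
  have "a \<in> carrier A \<and> b \<in> carrier B" using assms(1)
    by induction (use assms(4,5) in \<open>auto intro: A.meet_closed A.join_closed A.diff_closed A.zero_closed
        B.meet_closed B.join_closed B.diff_closed B.zero_closed\<close>)
  then show "a \<in> carrier A" "b \<in> carrier B" by auto
qed

text \<open>
  A pair in the generated subalgebra involves finitely many generators; as soon as these are in the
  list, all its cuts are in \<open>cut_pairs\<close>, because cuts are homomorphisms and \<open>cut_pairs\<close> is closed under
  the operations.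
\<close>

lemma generated_graph_cuts:
  assumes "left_handed_sba A" "left_handed_sba B" and X: "X \<subseteq> carrier A" "f \<in> X \<rightarrow> carrier B"
    and R: "generated_graph A B X f a b"
  obtains F where "finite F" "F \<subseteq> X" "\<And>ys Z. \<lbrakk>F \<subseteq> set ys; set ys \<subseteq> X\<rbrakk> \<Longrightarrow>
    (cut A (\<lambda>x. x) Z ys a, cut B f Z ys b) \<in> cut_pairs A B (\<lambda>x. x) f Z ys"
proof -
  interpret A: left_handed_sba A by fact
  interpret B: left_handed_sba B by fact
  define good where "good F a b \<longleftrightarrow> finite F \<and> F \<subseteq> X \<and> (\<forall>ys Z. F \<subseteq> set ys \<and> set ys \<subseteq> X \<longrightarrow>
    (cut A (\<lambda>x. x) Z ys a, cut B f Z ys b) \<in> cut_pairs A B (\<lambda>x. x) f Z ys)" for F a b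
  have step: "\<exists>F. good F (a \<sqinter>\<^bsub>A\<^esub> a') (b \<sqinter>\<^bsub>B\<^esub> b')" "\<exists>F. good F (a \<squnion>\<^bsub>A\<^esub> a') (b \<squnion>\<^bsub>B\<^esub> b')"
    "\<exists>F. good F (a \<setminus>\<^bsub>A\<^esub> a') (b \<setminus>\<^bsub>B\<^esub> b')"
    if R: "generated_graph A B X f a b" "generated_graph A B X f a' b'"
      and G: "\<exists>F. good F a b" "\<exists>F. good F a' b'" for a a' b b'
  proof -
    obtain F F' where F: "good F a b" "good F' a' b'" using G by blast
    have c: "a \<in> carrier A" "b \<in> carrier B" "a' \<in> carrier A" "b' \<in> carrier B"
      using generated_graph_closed[OF R(1)] generated_graph_closed[OF R(2)] X
        A.skew_boolean_algebra_axioms B.skew_boolean_algebra_axioms by blast+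
    have *: "(cut A (\<lambda>x. x) Z ys (a \<sqinter>\<^bsub>A\<^esub> a'), cut B f Z ys (b \<sqinter>\<^bsub>B\<^esub> b')) \<in> cut_pairs A B (\<lambda>x. x) f Z ys
      \<and> (cut A (\<lambda>x. x) Z ys (a \<squnion>\<^bsub>A\<^esub> a'), cut B f Z ys (b \<squnion>\<^bsub>B\<^esub> b')) \<in> cut_pairs A B (\<lambda>x. x) f Z ys
      \<and> (cut A (\<lambda>x. x) Z ys (a \<setminus>\<^bsub>A\<^esub> a'), cut B f Z ys (b \<setminus>\<^bsub>B\<^esub> b')) \<in> cut_pairs A B (\<lambda>x. x) f Z ys"
      if ys: "F \<union> F' \<subseteq> set ys" "set ys \<subseteq> X" for ys Z
    proof -
      have k: "y \<in> carrier A" "f y \<in> carrier B" if "y \<in> set ys" for y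
        using that ys X by auto
      note hA = sba_homD[OF A.cut_hom[of ys "\<lambda>x. x" Z]]
        and hB = sba_homD[OF B.cut_hom[of ys f Z]]
      have "(cut A (\<lambda>x. x) Z ys a, cut B f Z ys b) \<in> cut_pairs A B (\<lambda>x. x) f Z ys"
        "(cut A (\<lambda>x. x) Z ys a', cut B f Z ys b') \<in> cut_pairs A B (\<lambda>x. x) f Z ys"
        using F ys by (auto simp: good_def)
      from cut_pairs_closed[OF assms(1,2) k this] show ?thesis
        by (simp add: hA hB k c)
    qed
    have "finite (F \<union> F')" "F \<union> F' \<subseteq> X" using F by (auto simp: good_def)
    with * show "\<exists>F. good F (a \<sqinter>\<^bsub>A\<^esub> a') (b \<sqinter>\<^bsub>B\<^esub> b')" "\<exists>F. good F (a \<squnion>\<^bsub>A\<^esub> a') (b \<squnion>\<^bsub>B\<^esub> b')"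
      "\<exists>F. good F (a \<setminus>\<^bsub>A\<^esub> a') (b \<setminus>\<^bsub>B\<^esub> b')"
      unfolding good_def by meson+
  qed
  have "\<exists>F. good F a b" using R
  proof induction
    case (gen x)
    have "good {x} x (f x)" unfolding good_def
    proof (intro conjI allI impI)
      fix ys Z assume ys: "{x} \<subseteq> set ys \<and> set ys \<subseteq> X"
      show "(cut A (\<lambda>x. x) Z ys x, cut B f Z ys (f x)) \<in> cut_pairs A B (\<lambda>x. x) f Z ys"
        by (rule cut_pairs_generator[OF assms(1,2)]) (use ys X in auto)
    qed (use gen in auto)
    then show ?case ..
  next
    case zero
    have "good {} \<zero>\<^bsub>A\<^esub> \<zero>\<^bsub>B\<^esub>" unfolding good_def
    proof (intro conjI allI impI)
      fix ys Z assume ys: "{} \<subseteq> set ys \<and> set ys \<subseteq> X"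
      then have "cut A (\<lambda>x. x) Z ys \<zero>\<^bsub>A\<^esub> = \<zero>\<^bsub>A\<^esub>" "cut B f Z ys \<zero>\<^bsub>B\<^esub> = \<zero>\<^bsub>B\<^esub>"
        using X by (auto intro!: sba_homD(2)[OF A.cut_hom] sba_homD(2)[OF B.cut_hom])
      then show "(cut A (\<lambda>x. x) Z ys \<zero>\<^bsub>A\<^esub>, cut B f Z ys \<zero>\<^bsub>B\<^esub>) \<in> cut_pairs A B (\<lambda>x. x) f Z ys"
        by (simp add: cut_pairs_def)
    qed auto
    then show ?case ..
  qed (blast intro: step)+
  then obtain F where "good F a b" ..
  then show ?thesis by (intro that[of F]) (simp_all add: good_def)
qed

text \<open>
  The atomic terms with positive variables \<open>Z\<close> among the variables \<open>ys\<close> have distinct nonzero values.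
\<close>

definition atoms_separated :: "'a skew_alg \<Rightarrow> 'a set \<Rightarrow> bool" where
  "atoms_separated S X \<longleftrightarrow> (\<forall>ys Z. set ys \<subseteq> X \<and> Z \<subseteq> set ys \<longrightarrow>
     inj_on (cut S (\<lambda>x. x) Z ys) Z \<and> (\<forall>u\<in>Z. cut S (\<lambda>x. x) Z ys u \<noteq> \<zero>\<^bsub>S\<^esub>))"

text \<open>
  Separated atoms make \<open>cut_pairs\<close> the graph of a partial function, so the cuts of \<open>b\<close> and \<open>b'\<close> agree.
\<close>

lemma generated_graph_functional:
  assumes "left_handed_sba A" "left_handed_sba B" and X: "X \<subseteq> carrier A" "f \<in> X \<rightarrow> carrier B"
    and sep: "atoms_separated A X"
    and R: "generated_graph A B X f a b" "generated_graph A B X f a b'"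
  shows "b = b'"
proof -
  interpret A: left_handed_sba A by fact
  interpret B: left_handed_sba B by fact
  obtain F where F: "finite F" "F \<subseteq> X" "\<And>ys Z. \<lbrakk>F \<subseteq> set ys; set ys \<subseteq> X\<rbrakk> \<Longrightarrow>
    (cut A (\<lambda>x. x) Z ys a, cut B f Z ys b) \<in> cut_pairs A B (\<lambda>x. x) f Z ys"
    using generated_graph_cuts[OF assms(1-4) R(1)] by blast
  obtain F' where F': "finite F'" "F' \<subseteq> X" "\<And>ys Z. \<lbrakk>F' \<subseteq> set ys; set ys \<subseteq> X\<rbrakk> \<Longrightarrow>
    (cut A (\<lambda>x. x) Z ys a, cut B f Z ys b') \<in> cut_pairs A B (\<lambda>x. x) f Z ys"
    using generated_graph_cuts[OF assms(1-4) R(2)] by blast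
  obtain ys where ys: "set ys = F \<union> F'" "distinct ys"
    using finite_distinct_list[of "F \<union> F'"] F(1) F'(1) by auto
  show ?thesis
  proof (rule B.eq_if_all_cuts_eq[of ys f])
    show "b \<in> carrier B" "b' \<in> carrier B"
      using generated_graph_closed[OF R(1)] generated_graph_closed[OF R(2)] X
        A.skew_boolean_algebra_axioms B.skew_boolean_algebra_axioms by blast+
    show "f y \<in> carrier B" if "y \<in> set ys" for y using that ys(1) F(2) F'(2) X(2) by auto
    fix Z assume Z: "Z \<subseteq> set ys"
    have X': "set ys \<subseteq> X" using ys(1) F(2) F'(2) by simp
    have sub: "F \<subseteq> set ys" "F' \<subseteq> set ys" using ys(1) by auto
    have inj: "inj_on (cut A (\<lambda>x. x) Z ys) Z" and nz: "\<And>u. u \<in> Z \<Longrightarrow> cut A (\<lambda>x. x) Z ys u \<noteq> \<zero>\<^bsub>A\<^esub>"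
      using sep Z X' unfolding atoms_separated_def by blast+
    have "q = q'" if "(p, q) \<in> cut_pairs A B (\<lambda>x. x) f Z ys" "(p, q') \<in> cut_pairs A B (\<lambda>x. x) f Z ys"
      for p q q'
      using that unfolding cut_pairs_def by (auto simp: nz nz[THEN not_sym] inj_on_eq_iff[OF inj])
    from this[OF F(3)[OF sub(1) X'] F'(3)[OF sub(2) X']]
    show "cut B f Z ys b = cut B f Z ys b'" .
  qed fact
qed

text \<open>
  The generated graph is functional by separation and total because \<open>X\<close> generates \<open>A\<close>; being a
  subalgebra of \<open>A \<times> B\<close>, it is a homomorphism.
\<close>

lemma atoms_separated_extension:
  assumes "left_handed_sba A" "left_handed_sba B" and X: "X \<subseteq> carrier A" "f \<in> X \<rightarrow> carrier B"
    and gen: "generated A X = carrier A" and sep: "atoms_separated A X"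
  shows "\<exists>!h. h \<in> sba_hom A B \<and> h \<in> extensional (carrier A) \<and> (\<forall>x\<in>X. h x = f x)"
proof (rule ex_ex1I)
  interpret A: left_handed_sba A by fact
  interpret B: left_handed_sba B by fact
  define h where "h = (\<lambda>a\<in>carrier A. THE b. generated_graph A B X f a b)"
  note closed = generated_graph_closed[OF _ A.skew_boolean_algebra_axioms B.skew_boolean_algebra_axioms X]
  have h_eq: "h a = b" if "generated_graph A B X f a b" for a b
  proof -
    have "(THE b. generated_graph A B X f a b) = b"
      using that generated_graph_functional[OF assms(1-4) sep _ that] by (rule the_equality)
    then show ?thesis using closed(1)[OF that] by (simp add: h_def)
  qed
  have h: "generated_graph A B X f a (h a)" if a: "a \<in> carrier A" for a
  proof -
    obtain b where "generated_graph A B X f a b" using generated_graph_total[of a A X B f] a gen by blast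
    then show ?thesis using h_eq by metis
  qed
  have "h \<in> sba_hom A B"
  proof (rule in_sba_homI)
    show "h a \<in> carrier B" if "a \<in> carrier A" for a using closed(2)[OF h[OF that]] .
  qed (rule h_eq; intro generated_graph.intros h; assumption)+
  moreover have "\<forall>x\<in>X. h x = f x" using h_eq generated_graph.gen by metis
  moreover have "h \<in> extensional (carrier A)" unfolding h_def by (rule restrict_extensional)
  ultimately show "\<exists>h. h \<in> sba_hom A B \<and> h \<in> extensional (carrier A) \<and> (\<forall>x\<in>X. h x = f x)"
    by blast
next
  fix h k assume "h \<in> sba_hom A B \<and> h \<in> extensional (carrier A) \<and> (\<forall>x\<in>X. h x = f x)"
    "k \<in> sba_hom A B \<and> k \<in> extensional (carrier A) \<and> (\<forall>x\<in>X. k x = f x)"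
  then show "h = k"
    by (intro sba_hom_unique[OF gen, of h B k]) simp_all
qed


section \<open>Atomic terms as cuts of generators\<close>

context left_handed_sba
begin

lemma foldl_meet_eq_cut:
  "set zs \<subseteq> Z \<Longrightarrow> foldl (meet S) e zs = cut S (\<lambda>x. x) Z zs e"
  by (induction zs arbitrary: e) (auto simp: split_step_def)

lemma diff_foldl_join_eq_cut:
  assumes "set ws \<inter> Z = {}" "set ws \<subseteq> carrier S" "w \<in> carrier S" "e \<in> carrier S"
  shows "e \<setminus> foldl (join S) w ws = cut S (\<lambda>x. x) Z ws (e \<setminus> w)"
  using assms
  by (induction ws arbitrary: w) (auto simp: split_step_def diff_join_eq_diff_diff)

text \<open>
  Meeting \<open>y\<^sub>1\<close> with \<open>y\<^sub>2, \<dots>, y\<^sub>k\<close> and subtracting a join is a sequence of splitting steps, since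
  subtracting a join amounts to subtracting its members one after the other; the step for \<open>y\<^sub>1\<close> fixes
  \<open>y\<^sub>1\<close>.
\<close>

lemma atomic_term_value_eq_cut:
  assumes "set ys \<subseteq> carrier S" "distinct ys" "1 \<le> k" "k \<le> length ys"
  shows "atomic_term_value S k ys = cut S (\<lambda>x. x) (set (take k ys)) ys (hd ys)"
proof -
  define Z where "Z = set (take k ys)"
  obtain u zs where zs: "take k ys = u # zs"
    using assms(3,4) by (cases "take k ys") auto
  have ys: "ys = u # zs @ drop k ys" using append_take_drop_id[of k ys] zs by simp
  have hd: "hd ys = u" by (subst ys) simp
  have Z: "Z = insert u (set zs)" by (simp add: Z_def zs)
  have cl: "u \<in> carrier S" "set zs \<subseteq> carrier S" "set (drop k ys) \<subseteq> carrier S"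
    using assms(1) zs set_take_subset[of k ys] set_drop_subset[of k ys] by auto
  have m: "list_meet S (take k ys) = cut S (\<lambda>x. x) Z zs u"
    using foldl_meet_eq_cut[of zs Z u] by (auto simp: zs list_meet_def Z)
  have mc: "cut S (\<lambda>x. x) Z zs u \<in> carrier S" using cl by (auto intro!: cut_closed)
  have "cut S (\<lambda>x. x) Z ys u = cut S (\<lambda>x. x) Z (zs @ drop k ys) (split_step S (\<lambda>x. x) Z u u)"
    by (subst ys) simp
  also have "split_step S (\<lambda>x. x) Z u u = u" using cl by (simp add: split_step_def Z)
  finally have r: "cut S (\<lambda>x. x) Z ys u = cut S (\<lambda>x. x) Z (drop k ys) (cut S (\<lambda>x. x) Z zs u)"
    by (simp add: cut_append)
  show ?thesis
  proof (cases "drop k ys")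
    case Nil
    then show ?thesis using assms(4) m r hd by (simp add: atomic_term_value_def Z_def)
  next
    case (Cons w ws)
    have disj: "set (drop k ys) \<inter> Z = {}"
      using set_take_disj_set_drop_if_distinct[OF assms(2), of k k] by (auto simp: Z_def)
    have "list_meet S (take k ys) \<setminus> list_join S (drop k ys)
        = cut S (\<lambda>x. x) Z ws (cut S (\<lambda>x. x) Z zs u \<setminus> w)"
      unfolding m Cons list_join_def using disj cl(3) mc Cons
      by (auto intro!: diff_foldl_join_eq_cut)
    also have "\<dots> = cut S (\<lambda>x. x) Z (drop k ys) (cut S (\<lambda>x. x) Z zs u)"
      using disj Cons by (simp add: split_step_def)
    finally show ?thesis using Cons r hd by (auto simp: atomic_term_value_def Z_def)
  qed
qed

lemma atomic_outcomes_eq_cuts: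
  assumes "F \<subseteq> carrier S" "set xs = F"
  shows "atomic_outcomes S F =
    (\<lambda>(u, Z). cut S (\<lambda>x. x) Z xs u) ` (SIGMA u:F. {Z. u \<in> Z \<and> Z \<subseteq> F})"
proof (intro equalityI subsetI)
  fix t assume "t \<in> atomic_outcomes S F"
  then obtain k ys where t: "t = atomic_term_value S k ys" and ys: "set ys = F" "distinct ys"
    and k: "1 \<le> k" "k \<le> card F"
    by (auto simp: atomic_outcomes_def permutations_of_set_def)
  have k': "k \<le> length ys" using k ys distinct_card[of ys] by simp
  have "hd ys \<in> set (take k ys)"
  proof -
    have "take k ys \<noteq> []" using k(1) k' by auto
    then show ?thesis using hd_in_set[of "take k ys"] k(1) by (simp add: hd_take)
  qed
  moreover have "set (take k ys) \<subseteq> F" using set_take_subset[of k ys] ys(1) by simp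
  moreover have "t = cut S (\<lambda>x. x) (set (take k ys)) xs (hd ys)"
    unfolding t atomic_term_value_eq_cut[OF assms(1)[folded ys(1)] ys(2) k(1) k']
    using assms(1) assms(2)[symmetric] ys(1) \<open>hd ys \<in> set (take k ys)\<close> \<open>set (take k ys) \<subseteq> F\<close>
    by (intro cut_cong_set) auto
  ultimately show "t \<in> (\<lambda>(u, Z). cut S (\<lambda>x. x) Z xs u) ` (SIGMA u:F. {Z. u \<in> Z \<and> Z \<subseteq> F})"
    by (intro image_eqI[of _ _ "(hd ys, set (take k ys))"]) auto
next
  fix t assume "t \<in> (\<lambda>(u, Z). cut S (\<lambda>x. x) Z xs u) ` (SIGMA u:F. {Z. u \<in> Z \<and> Z \<subseteq> F})"
  then obtain u Z where u: "u \<in> Z" "Z \<subseteq> F" and t: "t = cut S (\<lambda>x. x) Z xs u" by auto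
  have fin: "finite F" using assms(2) by auto
  obtain zs where zs: "set zs = Z - {u}" "distinct zs"
    using finite_distinct_list[of "Z - {u}"] fin u finite_subset by blast
  obtain ws where ws: "set ws = F - Z" "distinct ws"
    using finite_distinct_list[of "F - Z"] fin by blast
  define ys where "ys = u # zs @ ws"
  define k where "k = Suc (length zs)"
  have ys: "set ys = F" "distinct ys" using u zs ws by (auto simp: ys_def)
  have k: "1 \<le> k" "k \<le> length ys" by (auto simp: k_def ys_def)
  have tk: "set (take k ys) = Z" "hd ys = u" using zs u by (auto simp: k_def ys_def)
  have "atomic_term_value S k ys = t"
    unfolding t atomic_term_value_eq_cut[OF assms(1)[folded ys(1)] ys(2) k] tk
    using assms ys u by (intro cut_cong_set) auto
  moreover have "k \<le> card F" using k(2) distinct_card[OF ys(2)] ys(1) by simp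
  ultimately show "t \<in> atomic_outcomes S F"
    using ys k(1) by (auto simp: atomic_outcomes_def permutations_of_set_def)
qed

end

text \<open>
  This counts the atomic terms up to identification: the positive variables with a first one.
\<close>

lemma card_pointed_subsets:
  assumes "finite F"
  shows "card (SIGMA u:F. {Z. u \<in> Z \<and> Z \<subseteq> F}) = card F * 2 ^ (card F - 1)"
proof -
  have "card {Z. u \<in> Z \<and> Z \<subseteq> F} = 2 ^ (card F - 1)" if "u \<in> F" for u
  proof -
    have "{Z. u \<in> Z \<and> Z \<subseteq> F} = insert u ` Pow (F - {u})"
    proof (intro equalityI subsetI)
      fix Z assume "Z \<in> {Z. u \<in> Z \<and> Z \<subseteq> F}"
      then have "Z = insert u (Z - {u})" "Z - {u} \<in> Pow (F - {u})" by auto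
      then show "Z \<in> insert u ` Pow (F - {u})" by blast
    qed (use that in auto)
    moreover have "inj_on (insert u) (Pow (F - {u}))"
      by (rule inj_onI) (metis Diff_insert_absorb PowD insertCI subset_Diff_insert)
    ultimately show ?thesis using assms that by (simp add: card_image card_Pow)
  qed
  then show ?thesis using assms by (subst card_SigmaI) (auto simp: finite_subset)
qed

text \<open>
  The outcomes are the image of the set counted in \<open>card_pointed_subsets\<close>, so the count says that the
  parametrization is injective.  Separation gives injectivity for each single \<open>Z\<close>; two different sets
  \<open>Z\<close> never share a nonzero value, since the value recovers \<open>Z\<close> as the set of those given
  generators to which it is not orthogonal.
\<close>

lemma atomic_outcomes_iff_atoms_separated:
  assumes "left_handed_sba S" "X \<subseteq> carrier S"
  shows "(\<forall>F n. finite F \<and> F \<subseteq> X \<and> card F = n \<longrightarrow>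
      card (atomic_outcomes S F) = n * 2 ^ (n - 1) \<and> \<zero>\<^bsub>S\<^esub> \<notin> atomic_outcomes S F)
    \<longleftrightarrow> atoms_separated S X" (is "?iii \<longleftrightarrow> _")
proof -
  interpret left_handed_sba S by fact
  let ?P = "\<lambda>F. SIGMA u:F. {Z. u \<in> Z \<and> Z \<subseteq> F}"
  let ?c = "\<lambda>xs (u, Z). cut S (\<lambda>x. x) Z xs u"
  have fin: "finite (?P F)" if "finite F" for F :: "'a set"
    using that by (auto simp: finite_subset)
  show ?thesis
  proof
    assume iii: ?iii
    show "atoms_separated S X" unfolding atoms_separated_def
    proof (intro allI impI)
      fix ys Z assume ys: "set ys \<subseteq> X \<and> Z \<subseteq> set ys"
      have o: "atomic_outcomes S (set ys) = ?c ys ` ?P (set ys)"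
        using ys assms(2) by (intro atomic_outcomes_eq_cuts) auto
      have iii': "card (atomic_outcomes S (set ys)) = card (?P (set ys))"
        "\<zero>\<^bsub>S\<^esub> \<notin> atomic_outcomes S (set ys)"
        using iii ys card_pointed_subsets[of "set ys"] by simp_all
      have inj: "inj_on (?c ys) (?P (set ys))"
        using iii'(1) fin[of "set ys"] unfolding o by (intro eq_card_imp_inj_on) auto
      have "inj_on (cut S (\<lambda>x. x) Z ys) Z"
      proof (rule inj_onI)
        fix u v assume "u \<in> Z" "v \<in> Z" "cut S (\<lambda>x. x) Z ys u = cut S (\<lambda>x. x) Z ys v"
        then show "u = v" using inj_onD[OF inj, of "(u, Z)" "(v, Z)"] ys by auto
      qed
      moreover have "cut S (\<lambda>x. x) Z ys u \<noteq> \<zero>\<^bsub>S\<^esub>" if "u \<in> Z" for u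
      proof
        assume "cut S (\<lambda>x. x) Z ys u = \<zero>\<^bsub>S\<^esub>"
        then have "\<zero>\<^bsub>S\<^esub> = ?c ys (u, Z)" by simp
        moreover have "(u, Z) \<in> ?P (set ys)" using that ys by auto
        ultimately show False using iii'(2) unfolding o by blast
      qed
      ultimately show "inj_on (cut S (\<lambda>x. x) Z ys) Z \<and> (\<forall>u\<in>Z. cut S (\<lambda>x. x) Z ys u \<noteq> \<zero>\<^bsub>S\<^esub>)"
        by blast
    qed
  next
    assume sep: "atoms_separated S X"
    show ?iii
    proof (intro allI impI, elim conjE)
      fix F n assume F: "finite F" "F \<subseteq> X" "card F = n"
      obtain ys where ys: "set ys = F" using finite_list[OF F(1)] by blast
      have g: "y \<in> carrier S" if "y \<in> set ys" for y using that ys F assms(2) by auto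
      have o: "atomic_outcomes S F = ?c ys ` ?P F"
        using F ys assms(2) by (intro atomic_outcomes_eq_cuts) auto
      have sep: "inj_on (cut S (\<lambda>x. x) Z ys) Z" "\<And>u. u \<in> Z \<Longrightarrow> cut S (\<lambda>x. x) Z ys u \<noteq> \<zero>\<^bsub>S\<^esub>"
        if "Z \<subseteq> F" for Z
        using sep that F(2) ys unfolding atoms_separated_def by blast+
      have sub: "Z \<subseteq> Z'" if "u \<in> Z" "Z \<subseteq> F" "u' \<in> Z'" "Z' \<subseteq> F"
        and eq: "cut S (\<lambda>x. x) Z ys u = cut S (\<lambda>x. x) Z' ys u'" for u u' Z Z'
      proof
        fix y assume y: "y \<in> Z"
        have "cut S (\<lambda>x. x) Z ys u \<sqinter>\<^bsub>S\<^esub> y = cut S (\<lambda>x. x) Z ys u"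
          by (rule cut_meet_generator(1)[OF g _ _ y]) (use y that g ys in auto)
        moreover have "cut S (\<lambda>x. x) Z' ys u' \<sqinter>\<^bsub>S\<^esub> y = \<zero>\<^bsub>S\<^esub>" if "y \<notin> Z'"
          by (rule cut_meet_generator(3)[OF g _ _ that]) (use y \<open>Z \<subseteq> F\<close> \<open>u' \<in> Z'\<close> \<open>Z' \<subseteq> F\<close> g ys in auto)
        ultimately show "y \<in> Z'" using eq sep(2)[OF that(2,1)] by metis
      qed
      have "inj_on (?c ys) (?P F)"
      proof (rule inj_onI, clarify)
        fix u Z u' Z' assume *: "u \<in> Z" "Z \<subseteq> F" "u' \<in> Z'" "Z' \<subseteq> F"
          and eq: "cut S (\<lambda>x. x) Z ys u = cut S (\<lambda>x. x) Z' ys u'"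
        have "Z = Z'" using sub[OF * eq] sub[OF *(3,4,1,2) eq[symmetric]] by blast
        then show "u = u' \<and> Z = Z'" using inj_onD[OF sep(1)[OF *(2)], of u u'] * eq by blast
      qed
      then have "card (atomic_outcomes S F) = n * 2 ^ (n - 1)"
        unfolding o using card_pointed_subsets[OF F(1)] F(3) by (simp add: card_image)
      moreover have "\<zero>\<^bsub>S\<^esub> \<notin> atomic_outcomes S F"
      proof
        assume "\<zero>\<^bsub>S\<^esub> \<in> atomic_outcomes S F"
        then obtain u Z where "\<zero>\<^bsub>S\<^esub> = cut S (\<lambda>x. x) Z ys u" "u \<in> Z" "Z \<subseteq> F" unfolding o by auto
        then show False using sep(2)[of Z u] by simp
      qed
      ultimately show "card (atomic_outcomes S F) = n * 2 ^ (n - 1) \<and> \<zero>\<^bsub>S\<^esub> \<notin> atomic_outcomes S F" ..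
    qed
  qed
qed


section \<open>Homomorphisms to primitive algebras\<close>

text \<open>
  The left-handed algebra with zero \<open>z\<close> whose nonzero elements \<open>A\<close> form one \<open>\<D>\<close>-class.
\<close>

definition primitive :: "'a \<Rightarrow> 'a set \<Rightarrow> 'a skew_alg" where
  "primitive z A = \<lparr>carrier = insert z A,
     meet = (\<lambda>x y. if x = z \<or> y = z then z else x),
     join = (\<lambda>x y. if y = z then x else y),
     diff = (\<lambda>x y. if y = z then x else z),
     zero = z\<rparr>"

lemma left_handed_primitive: "left_handed_sba (primitive z A)"
  by unfold_locales (auto simp: primitive_def)

lemma generalized_boolean_primitive: "generalized_boolean_algebra (primitive z {a})"
  by unfold_locales (auto simp: primitive_def)

text \<open>
  Cutting along the set of those elements that are nonzero changes nothing, as all nonzero elements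
  of a primitive algebra are \<open>\<D>\<close>-equivalent.
\<close>

lemma cut_primitive:
  "(\<And>y. y \<in> set ys \<Longrightarrow> g y \<noteq> z \<longleftrightarrow> y \<in> Z) \<Longrightarrow> cut (primitive z A) g Z ys e = e"
  by (induction ys arbitrary: e) (auto simp: split_step_def primitive_def)

lemma hom_primitive_cut:
  assumes "left_handed_sba S" "h \<in> sba_hom S (primitive z A)" "set ys \<subseteq> carrier S" "u \<in> carrier S"
    and "\<And>y. y \<in> set ys \<Longrightarrow> h y \<noteq> z \<longleftrightarrow> y \<in> Z"
  shows "h (cut S (\<lambda>x. x) Z ys u) = h u"
proof -
  have "h (cut S (\<lambda>x. x) Z ys u) = cut (primitive z A) (h \<circ> (\<lambda>x. x)) Z ys (h u)"
    using assms by (intro hom_cut) auto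
  also have "\<dots> = h u" using assms(5) by (intro cut_primitive) auto
  finally show ?thesis .
qed

text \<open>
  To tell \<open>u \<in> Z\<close> from the other members of \<open>Z\<close>, send \<open>u\<close> to one nonzero element, the rest of \<open>Z\<close> to
  another one, and everything else to zero.
\<close>

lemma free_imp_atoms_separated:
  assumes "left_handed_sba S" "free_on TYPE('b) Left_Handed S X" "infinite (UNIV :: 'b set)"
  shows "atoms_separated S X"
proof -
  obtain T :: "'b set" where "card T = 3"
    using infinite_arbitrarily_large[OF assms(3), of 3] by auto
  then obtain z a b :: 'b where zab: "z \<noteq> a" "z \<noteq> b" "a \<noteq> b" by (auto simp: card_3_iff)
  have X: "X \<subseteq> carrier S" using assms(2) by (simp add: free_on_def)
  show ?thesis unfolding atoms_separated_def
  proof (intro allI impI)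
    fix ys Z assume ys: "set ys \<subseteq> X \<and> Z \<subseteq> set ys"
    have *: "cut S (\<lambda>x. x) Z ys u \<noteq> \<zero>\<^bsub>S\<^esub> \<and> (\<forall>v\<in>Z. v \<noteq> u \<longrightarrow> cut S (\<lambda>x. x) Z ys u \<noteq> cut S (\<lambda>x. x) Z ys v)"
      if u: "u \<in> Z" for u
    proof -
      define f where "f w = (if w \<notin> Z then z else if w = u then a else b)" for w
      have "f \<in> X \<rightarrow> carrier (primitive z {a, b})" by (auto simp: f_def primitive_def)
      then obtain h where h: "h \<in> sba_hom S (primitive z {a, b})" "\<forall>x\<in>X. h x = f x"
        using assms(2) left_handed_primitive[of z "{a, b}"] unfolding free_on_def in_variety.simps
        by blast
      have hc: "h (cut S (\<lambda>x. x) Z ys v) = f v" if "v \<in> Z" for v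
      proof -
        have "h (cut S (\<lambda>x. x) Z ys v) = h v"
        proof (rule hom_primitive_cut[OF assms(1) h(1)])
          show "h y \<noteq> z \<longleftrightarrow> y \<in> Z" if "y \<in> set ys" for y
          proof -
            have "h y = f y" using h(2) ys that by blast
            then show ?thesis using zab by (auto simp: f_def)
          qed
        qed (use ys X that in auto)
        then show ?thesis using h(2) ys that by auto
      qed
      have "h \<zero>\<^bsub>S\<^esub> = z" using sba_homD(2)[OF h(1)] by (simp add: primitive_def)
      then have "cut S (\<lambda>x. x) Z ys u \<noteq> \<zero>\<^bsub>S\<^esub>" using hc[OF u] zab u by (auto simp: f_def)
      moreover have "cut S (\<lambda>x. x) Z ys u \<noteq> cut S (\<lambda>x. x) Z ys v" if "v \<in> Z" "v \<noteq> u" for v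
        using hc[OF u] hc[OF that(1)] zab u that by (auto simp: f_def)
      ultimately show ?thesis by blast
    qed
    have "inj_on (cut S (\<lambda>x. x) Z ys) Z" by (rule inj_onI) (use * in metis)
    with * show "inj_on (cut S (\<lambda>x. x) Z ys) Z \<and> (\<forall>u\<in>Z. cut S (\<lambda>x. x) Z ys u \<noteq> \<zero>\<^bsub>S\<^esub>)" by blast
  qed
qed

lemma free_iff_atoms_separated:
  assumes "left_handed_sba S" "X \<subseteq> carrier S" "generated S X = carrier S" "infinite (UNIV :: 'b set)"
  shows "free_on TYPE('b) Left_Handed S X \<longleftrightarrow> atoms_separated S X"
proof
  assume sep: "atoms_separated S X"
  have "\<exists>!h. h \<in> sba_hom S B \<and> h \<in> extensional (carrier S) \<and> (\<forall>x\<in>X. h x = f x)"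
    if "left_handed_sba B" "f \<in> X \<rightarrow> carrier B" for B :: "'b skew_alg" and f
    by (rule atoms_separated_extension[OF assms(1) that(1) assms(2) that(2) assms(3) sep])
  then show "free_on TYPE('b) Left_Handed S X"
    using assms unfolding free_on_def by simp
qed (use assms free_imp_atoms_separated in blast)


section \<open>Subalgebras\<close>

lemma left_handed_generated_subalgebra:
  assumes "left_handed_sba S" "Y \<subseteq> carrier S"
  shows "left_handed_sba (generated_subalgebra S Y)"
proof -
  interpret left_handed_sba S by fact
  have c: "x \<in> generated S Y \<Longrightarrow> x \<in> carrier S" for x using generated_subset_carrier assms by blast
  show ?thesis
    by unfold_locales
      (simp_all add: generated_subalgebra_def c generated.intros
        meet_join_absorb join_meet_absorb join_absorb_meet meet_absorb_join distrib_left distrib_right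
        meet_diff_zero left_meet left_join, simp_all add: meet_assoc join_assoc c)
qed

lemma generated_carrier_update [simp]: "generated (S\<lparr>carrier := C\<rparr>) X = generated S X"
proof -
  have "x \<in> generated S X" if "x \<in> generated (S\<lparr>carrier := C\<rparr>) X" for x
    using that by induction (auto intro: generated.intros)
  moreover have "x \<in> generated (S\<lparr>carrier := C\<rparr>) X" if "x \<in> generated S X" for x
    using that
  proof induction
    case zero
    then show ?case using generated.zero[of "S\<lparr>carrier := C\<rparr>" X] by simp
  next
    case (meet x y)
    then show ?case using generated.meet[of x "S\<lparr>carrier := C\<rparr>" X y] by simp
  next
    case (join x y)
    then show ?case using generated.join[of x "S\<lparr>carrier := C\<rparr>" X y] by simp
  next
    case (diff x y)
    then show ?case using generated.diff[of x "S\<lparr>carrier := C\<rparr>" X y] by simp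
  qed (rule generated.gen)
  ultimately show ?thesis by blast
qed

lemma split_step_carrier_update [simp]: "split_step (S\<lparr>carrier := C\<rparr>) = split_step S"
  by (intro ext) (simp add: split_step_def)

lemma cut_carrier_update [simp]: "cut (S\<lparr>carrier := C\<rparr>) = cut S"
  by (intro ext) (simp add: cut_def)

lemma atoms_separated_carrier_update [simp]:
  "atoms_separated (S\<lparr>carrier := C\<rparr>) X = atoms_separated S X"
  by (simp add: atoms_separated_def)

lemma atoms_separated_iff_finite:
  "atoms_separated S X \<longleftrightarrow> (\<forall>Y. finite Y \<and> Y \<subseteq> X \<longrightarrow> atoms_separated S Y)"
proof
  assume *: "\<forall>Y. finite Y \<and> Y \<subseteq> X \<longrightarrow> atoms_separated S Y"
  show "atoms_separated S X" unfolding atoms_separated_def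
  proof (intro allI impI)
    fix ys Z assume ys: "set ys \<subseteq> X \<and> Z \<subseteq> set ys"
    then have "atoms_separated S (set ys)" using * by simp
    with ys show "inj_on (cut S (\<lambda>x. x) Z ys) Z \<and> (\<forall>u\<in>Z. cut S (\<lambda>x. x) Z ys u \<noteq> \<zero>\<^bsub>S\<^esub>)"
      unfolding atoms_separated_def by blast
  qed
qed (unfold atoms_separated_def, blast)


section \<open>The quotient by D\<close>

context left_handed_sba
begin

lemma D_rel_iff: "(x, y) \<in> D_rel S \<longleftrightarrow> x \<in> carrier S \<and> y \<in> carrier S \<and> x \<sqinter> y = x \<and> y \<sqinter> x = y"
  by (auto simp: D_rel_def left_meet)

lemma equiv_D_rel: "equiv (carrier S) (D_rel S)"
proof (rule equivI)
  show "trans (D_rel S)"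
  proof (rule transI)
    have "x \<sqinter> z = x" if "x \<in> carrier S" "y \<in> carrier S" "z \<in> carrier S" "x \<sqinter> y = x" "y \<sqinter> z = y" for x y z
      using meet_assoc[of x y z] that by simp
    then show "(x, z) \<in> D_rel S" if "(x, y) \<in> D_rel S" "(y, z) \<in> D_rel S" for x y z
      using that unfolding D_rel_iff by blast
  qed
qed (auto simp: D_rel_iff refl_on_def sym_def)

text \<open>
  In the left-handed case \<open>x \<D> y\<close> is the conjunction of \<open>x \<sqinter> y = x\<close> and \<open>y \<sqinter> x = y\<close>, and \<open>x \<sqinter> y = x\<close>
  is the preorder induced by the order of \<open>S/\<D>\<close>.  That \<open>\<D>\<close> is a congruence follows since \<open>\<sqinter>\<close> and
  \<open>\<squnion>\<close> are monotone for this preorder, while \<open>\<setminus>\<close> is monotone on the left and antitone on the right.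
\<close>

lemma D_meet_mono:
  assumes "x \<in> carrier S" "x' \<in> carrier S" "y \<in> carrier S" "y' \<in> carrier S"
    and "x \<sqinter> x' = x" "y \<sqinter> y' = y"
  shows "(x \<sqinter> y) \<sqinter> (x' \<sqinter> y') = x \<sqinter> y"
proof -
  have "(x \<sqinter> y) \<sqinter> (x' \<sqinter> y') = (x \<sqinter> x') \<sqinter> (y \<sqinter> y')" using assms(1-4) by (simp add: meet_nf)
  then show ?thesis using assms by simp
qed

lemma D_join_mono:
  assumes "x \<in> carrier S" "x' \<in> carrier S" "y \<in> carrier S" "y' \<in> carrier S"
    and "x \<sqinter> x' = x" "y \<sqinter> y' = y"
  shows "(x \<squnion> y) \<sqinter> (x' \<squnion> y') = x \<squnion> y"
proof -
  have "(x \<squnion> y) \<sqinter> (x' \<squnion> y') = (x \<sqinter> (x' \<squnion> y')) \<squnion> (y \<sqinter> (x' \<squnion> y'))"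
    using assms(1-4) by (simp add: distrib_right)
  also have "x \<sqinter> (x' \<squnion> y') = x" using assms by (simp add: distrib_left join_absorb_meet)
  also have "y \<sqinter> (x' \<squnion> y') = y" using assms by (simp add: distrib_left meet_join_absorb_left)
  finally show ?thesis .
qed

lemma D_diff_mono:
  assumes "x \<in> carrier S" "x' \<in> carrier S" "y \<in> carrier S" "y' \<in> carrier S"
    and "x \<sqinter> x' = x" "y' \<sqinter> y = y'"
  shows "(x \<setminus> y) \<sqinter> (x' \<setminus> y') = x \<setminus> y"
proof -
  have "(x \<setminus> y) \<sqinter> (x' \<sqinter> y') = (x \<setminus> y) \<sqinter> ((x' \<sqinter> y') \<sqinter> y)"
    using assms meet_assoc[of x' y' y] by simp
  also have "\<dots> = \<zero>" using assms(1-4) diff_meet_zero3(1)[of x "x' \<sqinter> y'" y] by simp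
  finally have z: "(x \<setminus> y) \<sqinter> (x' \<sqinter> y') = \<zero>" .
  have "(x \<setminus> y) = ((x \<setminus> y) \<sqinter> x) \<sqinter> x'"
    using assms meet_assoc[of "x \<setminus> y" x x'] by (simp add: meet_diff_self)
  also have "\<dots> = (x \<setminus> y) \<sqinter> x'" using assms(1-4) by (simp add: meet_diff_self)
  also have "\<dots> = (x \<setminus> y) \<sqinter> ((x' \<sqinter> y') \<squnion> (x' \<setminus> y'))" using assms(1-4) by (simp add: meet_diff_zero)
  also have "\<dots> = (x \<setminus> y) \<sqinter> (x' \<setminus> y')"
    using assms(1-4) z distrib_left[of "x \<setminus> y" "x' \<sqinter> y'" "x' \<setminus> y'"] by simp
  finally show ?thesis by simp
qed

lemma D_proj_eq_iff:
  assumes "x \<in> carrier S" "y \<in> carrier S"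
  shows "D_proj S x = D_proj S y \<longleftrightarrow> x \<sqinter> y = x \<and> y \<sqinter> x = y"
  unfolding D_proj_def using eq_equiv_class_iff[OF equiv_D_rel assms] assms by (simp add: D_rel_iff)

lemma D_quotient_carrier: "carrier (D_quotient S) = D_proj S ` carrier S"
  by (auto simp: D_quotient_def quotient_def D_proj_def)

lemma D_quotient_induced:
  assumes "\<And>x x' y y'. \<lbrakk>(x, x') \<in> D_rel S; (y, y') \<in> D_rel S\<rbrakk> \<Longrightarrow> D_proj S (f x y) = D_proj S (f x' y')"
    and "x \<in> carrier S" "y \<in> carrier S"
  shows "(\<Union>x'\<in>D_proj S x. \<Union>y'\<in>D_proj S y. D_proj S (f x' y')) = D_proj S (f x y)"
  unfolding D_proj_def[of S x] D_proj_def[of S y]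
  by (rule UN_equiv_class2[OF equiv_D_rel equiv_D_rel]) (use assms in \<open>auto simp: congruent2_def\<close>)

lemma D_quotient_ops:
  assumes "x \<in> carrier S" "y \<in> carrier S"
  shows "D_proj S x \<sqinter>\<^bsub>D_quotient S\<^esub> D_proj S y = D_proj S (x \<sqinter> y)"
    and "D_proj S x \<squnion>\<^bsub>D_quotient S\<^esub> D_proj S y = D_proj S (x \<squnion> y)"
    and "D_proj S x \<setminus>\<^bsub>D_quotient S\<^esub> D_proj S y = D_proj S (x \<setminus> y)"
  unfolding D_quotient_def skew_alg.simps
  by (rule D_quotient_induced[OF _ assms];
      clarsimp simp: D_proj_eq_iff D_rel_iff D_meet_mono D_join_mono D_diff_mono)+

lemma D_quotient_zero: "\<zero>\<^bsub>D_quotient S\<^esub> = D_proj S \<zero>"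
  by (simp add: D_quotient_def)

lemma D_proj_hom: "D_proj S \<in> sba_hom S (D_quotient S)"
  by (rule in_sba_homI) (auto simp: D_quotient_carrier D_quotient_ops D_quotient_zero)

text \<open>
  The laws pass from \<open>S\<close> to the quotient along the surjection; commutativity comes from
  \<open>x \<sqinter> y \<D> y \<sqinter> x\<close> and \<open>x \<squnion> y \<D> y \<squnion> x\<close>.
\<close>

lemma generalized_boolean_D_quotient: "generalized_boolean_algebra (D_quotient S)"
proof -
  have m: "D_proj S (x \<sqinter> y) = D_proj S (y \<sqinter> x)" if "x \<in> carrier S" "y \<in> carrier S" for x y
    using that by (simp add: D_proj_eq_iff meet_nf)
  have "(x \<squnion> y) \<sqinter> (y \<squnion> x) = x \<squnion> y" if "x \<in> carrier S" "y \<in> carrier S" for x y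
    using that distrib_right[of x y "y \<squnion> x"] distrib_left[of x y x]
    by (simp add: meet_join_absorb meet_join_absorb_left)
  then have j: "D_proj S (x \<squnion> y) = D_proj S (y \<squnion> x)" if "x \<in> carrier S" "y \<in> carrier S" for x y
    using that by (simp add: D_proj_eq_iff)
  note ops = D_quotient_ops D_quotient_zero
  note axioms = meet_join_absorb join_meet_absorb join_absorb_meet meet_absorb_join
    distrib_left distrib_right meet_join_diff meet_meet_diff diff_meet_meet
  show ?thesis
    apply unfold_locales
    apply (unfold D_quotient_carrier)
    apply ((elim imageE)?, hypsubst?, (simp add: ops; fail | simp add: ops axioms; fail
        | simp add: ops meet_assoc; fail | simp add: ops join_assoc; fail
        | simp only: ops, rule m j; assumption))+
    done
qed

lemma generated_D_quotient:
  assumes "X \<subseteq> carrier S" "generated S X = carrier S"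
  shows "generated (D_quotient S) (D_proj S ` X) = carrier (D_quotient S)"
proof
  interpret Q: generalized_boolean_algebra "D_quotient S" by (rule generalized_boolean_D_quotient)
  show "generated (D_quotient S) (D_proj S ` X) \<subseteq> carrier (D_quotient S)"
    by (rule Q.generated_subset_carrier) (use assms in \<open>auto simp: D_quotient_carrier\<close>)
  have "D_proj S x \<in> generated (D_quotient S) (D_proj S ` X)" if "x \<in> generated S X" for x
    using that
  proof induction
    case (gen x)
    then show ?case by (blast intro: generated.gen)
  next
    case zero
    then show ?case by (metis generated.zero D_quotient_zero)
  next
    case (meet x y)
    then show ?case by (metis generated.meet D_quotient_ops(1) assms(2))
  next
    case (join x y)
    then show ?case by (metis generated.join D_quotient_ops(2) assms(2))
  next
    case (diff x y)
    then show ?case by (metis generated.diff D_quotient_ops(3) assms(2))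
  qed
  then show "carrier (D_quotient S) \<subseteq> generated (D_quotient S) (D_proj S ` X)"
    by (auto simp: D_quotient_carrier assms(2))
qed

end

lemma generalized_boolean_imp_left_handed:
  assumes "generalized_boolean_algebra B"
  shows "left_handed_sba B"
proof -
  interpret generalized_boolean_algebra B by fact
  have i: "x \<sqinter>\<^bsub>B\<^esub> x = x" "x \<squnion>\<^bsub>B\<^esub> x = x" if "x \<in> carrier B" for x
    using meet_join_absorb[of x "x \<sqinter>\<^bsub>B\<^esub> x"] join_absorb_meet[of x x] join_absorb_meet[of x "x \<squnion>\<^bsub>B\<^esub> x"]
      meet_join_absorb[of x x] that meet_closed join_closed by simp_all
  show ?thesis
  proof unfold_locales
    fix x y assume c: "x \<in> carrier B" "y \<in> carrier B"
    have "(x \<sqinter>\<^bsub>B\<^esub> y) \<sqinter>\<^bsub>B\<^esub> x = x \<sqinter>\<^bsub>B\<^esub> (x \<sqinter>\<^bsub>B\<^esub> y)" using c by (intro meet_comm meet_closed)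
    then show "(x \<sqinter>\<^bsub>B\<^esub> y) \<sqinter>\<^bsub>B\<^esub> x = x \<sqinter>\<^bsub>B\<^esub> y" using c meet_assoc[of x x y] i by simp
    have "(x \<squnion>\<^bsub>B\<^esub> y) \<squnion>\<^bsub>B\<^esub> x = (y \<squnion>\<^bsub>B\<^esub> x) \<squnion>\<^bsub>B\<^esub> x" using c join_comm by simp
    then show "(x \<squnion>\<^bsub>B\<^esub> y) \<squnion>\<^bsub>B\<^esub> x = y \<squnion>\<^bsub>B\<^esub> x" using c join_assoc[of y x x] i by simp
  qed
qed

text \<open>
  A homomorphism to a commutative algebra identifies \<open>\<D>\<close>-equivalent elements, hence the extension
  to \<open>S\<close> of a map on the generators factors through \<open>S/\<D>\<close>.  Two \<open>\<D>\<close>-equivalent generators would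
  give the zero value \<open>x \<setminus> y\<close> of an atomic term.
\<close>

lemma atoms_separated_imp_quotient_free:
  assumes "left_handed_sba S" and X: "X \<subseteq> carrier S" and gen: "generated S X = carrier S"
    and sep: "atoms_separated S X"
  shows "quotient_free_on_image TYPE('b) S X"
proof -
  interpret left_handed_sba S by fact
  let ?Q = "D_quotient S" and ?p = "D_proj S"
  interpret Q: generalized_boolean_algebra ?Q by (rule generalized_boolean_D_quotient)
  have inj: "inj_on ?p X"
  proof (rule inj_onI, rule ccontr)
    fix x y assume xy: "x \<in> X" "y \<in> X" "?p x = ?p y" "x \<noteq> y"
    then have c: "x \<in> carrier S" "y \<in> carrier S" using X by auto
    then have "x \<sqinter>\<^bsub>S\<^esub> y = x" using xy(3) by (simp add: D_proj_eq_iff)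
    then have "cut S (\<lambda>x. x) {x} [x, y] x = \<zero>\<^bsub>S\<^esub>"
      using xy c by (simp add: split_step_def diff_eq_zero)
    moreover have "cut S (\<lambda>x. x) {x} [x, y] x \<noteq> \<zero>\<^bsub>S\<^esub>"
      using sep[unfolded atoms_separated_def, rule_format, of "[x, y]" "{x}"] xy by auto
    ultimately show False by simp
  qed
  have "\<exists>!h. h \<in> sba_hom ?Q B \<and> h \<in> extensional (carrier ?Q) \<and> (\<forall>P\<in>?p ` X. h P = f P)"
    if B: "generalized_boolean_algebra B" and f: "f \<in> ?p ` X \<rightarrow> carrier B" for B :: "'b skew_alg" and f
  proof (rule ex_ex1I)
    interpret B: generalized_boolean_algebra B by fact
    have "f \<circ> ?p \<in> X \<rightarrow> carrier B" using f by auto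
    from atoms_separated_extension[OF assms(1) generalized_boolean_imp_left_handed[OF B] X this gen sep]
    obtain h where h: "h \<in> sba_hom S B" "\<forall>x\<in>X. h x = f (?p x)" by auto
    have h_eq: "h x = h y" if "x \<in> carrier S" "y \<in> carrier S" "?p x = ?p y" for x y
    proof -
      have e: "x \<sqinter>\<^bsub>S\<^esub> y = x" "y \<sqinter>\<^bsub>S\<^esub> x = y" using that by (simp_all add: D_proj_eq_iff)
      have "h x = h x \<sqinter>\<^bsub>B\<^esub> h y" using sba_homD(3)[OF h(1) that(1,2)] unfolding e .
      also have "\<dots> = h y \<sqinter>\<^bsub>B\<^esub> h x" by (intro B.meet_comm sba_homD(1)[OF h(1)] that(1,2))
      also have "\<dots> = h y" using sba_homD(3)[OF h(1) that(2,1)] unfolding e by (rule sym)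
      finally show ?thesis .
    qed
    define k where "k = (\<lambda>P\<in>carrier ?Q. h (SOME x. x \<in> carrier S \<and> ?p x = P))"
    have k: "k (?p x) = h x" if x: "x \<in> carrier S" for x
    proof -
      let ?x = "SOME y. y \<in> carrier S \<and> ?p y = ?p x"
      have "?x \<in> carrier S \<and> ?p ?x = ?p x" by (rule someI[of _ x]) (simp add: x)
      then have "h ?x = h x" using h_eq x by blast
      then show ?thesis using x by (simp add: k_def D_quotient_carrier)
    qed
    have "k \<in> sba_hom ?Q B"
    proof (rule in_sba_homI)
      show "k \<zero>\<^bsub>?Q\<^esub> = \<zero>\<^bsub>B\<^esub>" using k[of "\<zero>\<^bsub>S\<^esub>"] sba_homD(2)[OF h(1)] by (simp add: D_quotient_zero)
    qed (unfold D_quotient_carrier, elim imageE, simp add: k D_quotient_ops sba_homD[OF h(1)],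
      (elim imageE, simp add: k D_quotient_ops sba_homD[OF h(1)])+)
    moreover have "k \<in> extensional (carrier ?Q)" unfolding k_def by (rule restrict_extensional)
    moreover have "\<forall>P\<in>?p ` X. k P = f P"
    proof
      fix P assume "P \<in> ?p ` X"
      then obtain x where "P = ?p x" "x \<in> X" by blast
      then show "k P = f P" using k[of x] h(2) X by auto
    qed
    ultimately show "\<exists>h. h \<in> sba_hom ?Q B \<and> h \<in> extensional (carrier ?Q) \<and> (\<forall>P\<in>?p ` X. h P = f P)"
      by blast
  next
    fix h k assume hk: "h \<in> sba_hom ?Q B \<and> h \<in> extensional (carrier ?Q) \<and> (\<forall>P\<in>?p ` X. h P = f P)"
      "k \<in> sba_hom ?Q B \<and> k \<in> extensional (carrier ?Q) \<and> (\<forall>P\<in>?p ` X. k P = f P)"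
    show "h = k"
    proof (rule sba_hom_unique[OF generated_D_quotient[OF X gen], of h B k])
      fix P assume "P \<in> ?p ` X"
      then have "h P = f P" "k P = f P" using hk by blast+
      then show "h P = k P" by simp
    qed (use hk in blast)+
  qed
  moreover have "?p ` X \<subseteq> carrier ?Q" using X by (auto simp: D_quotient_carrier)
  ultimately show ?thesis
    using inj Q.generalized_boolean_algebra_axioms
    unfolding quotient_free_on_image_def free_on_def by simp
qed

text \<open>
  A nonzero cut of \<open>a\<close> equals the cut of some \<open>u \<in> Z\<close>.  From \<open>a \<le> x\<close> it follows that \<open>x \<in> Z\<close> and that
  \<open>x\<close> has the same cut as \<open>u\<close>, and likewise for \<open>y\<close>; so \<open>x = y\<close> by separation.
\<close>

lemma atoms_separated_imp_disjoint_generators: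
  assumes "left_handed_sba S" and X: "X \<subseteq> carrier S" and gen: "generated S X = carrier S"
    and sep: "atoms_separated S X"
    and xy: "x \<in> X" "y \<in> X" "x \<noteq> y" and a: "a \<in> carrier S" "nat_le S a x" "nat_le S a y"
  shows "a = \<zero>\<^bsub>S\<^esub>"
proof -
  interpret left_handed_sba S by fact
  have "(\<lambda>x. x) \<in> X \<rightarrow> carrier S" using X by auto
  moreover have "generated_graph S S X (\<lambda>x. x) a a" using generated_graph_id[of a S X] gen a(1) by simp
  ultimately obtain F where F: "finite F" "F \<subseteq> X" "\<And>ys Z. \<lbrakk>F \<subseteq> set ys; set ys \<subseteq> X\<rbrakk> \<Longrightarrow>
    (cut S (\<lambda>x. x) Z ys a, cut S (\<lambda>x. x) Z ys a) \<in> cut_pairs S S (\<lambda>x. x) (\<lambda>x. x) Z ys"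
    using generated_graph_cuts[OF assms(1) assms(1) X, of "\<lambda>x. x" a a] by blast
  obtain ys where ys: "set ys = F \<union> {x, y}" "distinct ys"
    using finite_distinct_list[of "F \<union> {x, y}"] F(1) by auto
  have ysX: "set ys \<subseteq> X" using ys(1) F(2) xy by simp
  have g: "w \<in> carrier S" if "w \<in> set ys" for w using that ysX X by auto
  show ?thesis
  proof (rule eq_if_all_cuts_eq[OF g ys(2) a(1) zero_closed])
    fix Z assume Z: "Z \<subseteq> set ys"
    define c where "c = cut S (\<lambda>x. x) Z ys"
    have c: "c \<in> sba_hom S S" unfolding c_def by (rule cut_hom[OF g])
    have "c a = \<zero>\<^bsub>S\<^esub>"
    proof (rule ccontr)
      assume nz: "c a \<noteq> \<zero>\<^bsub>S\<^esub>"
      have "F \<subseteq> set ys" using ys(1) by blast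
      from F(3)[OF this ysX, of Z] nz obtain u where u: "u \<in> Z" "u \<in> set ys" "c a = c u"
        by (auto simp: cut_pairs_def c_def)
      have *: "w \<in> Z \<and> c w = c u" if w: "w \<in> set ys" and le: "nat_le S a w" for w
      proof -
        have "c (w \<sqinter>\<^bsub>S\<^esub> a) = c a" using le by (simp add: nat_le_def)
        then have e: "c w \<sqinter>\<^bsub>S\<^esub> c u = c u" using sba_homD(3)[OF c g[OF w] a(1)] u(3) by simp
        have "w \<in> Z"
        proof (rule ccontr)
          assume "w \<notin> Z"
          then have "c w = \<zero>\<^bsub>S\<^esub>"
            using cut_generator_zero[of ys "\<lambda>x. x" w Z] g w by (simp add: c_def)
          then show False using e nz u(3) sba_homD(1)[OF c g[OF u(2)]] by simp
        qed
        moreover from this have "c w \<sqinter>\<^bsub>S\<^esub> c u = c w"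
          using cut_generator_ops(1)[of ys "\<lambda>x. x" w Z u] g w u by (simp add: c_def)
        ultimately show ?thesis using e by simp
      qed
      have "x \<in> Z \<and> c x = c u" "y \<in> Z \<and> c y = c u" using * a ys(1) by simp_all
      moreover have "inj_on c Z" using sep ysX Z unfolding atoms_separated_def c_def by blast
      ultimately show False using xy(3) inj_onD[of c Z x y] by simp
    qed
    then show "cut S (\<lambda>x. x) Z ys a = cut S (\<lambda>x. x) Z ys \<zero>\<^bsub>S\<^esub>"
      using sba_homD(2)[OF c] by (simp add: c_def)
  qed
qed

text \<open>
  The map from \<open>X\<close> to the two-element algebra with support \<open>Z\<close> extends to \<open>S/\<D>\<close> and shows that the
  cut of \<open>u \<in> Z\<close> is nonzero.  A cut of \<open>u\<close> lies below \<open>u\<close>, so two generators in \<open>Z\<close> with equal cuts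
  would have a nonzero common lower bound.
\<close>

lemma quotient_free_imp_atoms_separated:
  assumes "left_handed_sba S" and X: "X \<subseteq> carrier S"
    and free: "quotient_free_on_image TYPE('b) S X" and inf: "infinite (UNIV :: 'b set)"
    and disj: "\<And>x y a. \<lbrakk>x \<in> X; y \<in> X; x \<noteq> y; a \<in> carrier S; nat_le S a x; nat_le S a y\<rbrakk> \<Longrightarrow> a = \<zero>\<^bsub>S\<^esub>"
  shows "atoms_separated S X"
  unfolding atoms_separated_def
proof (intro allI impI)
  interpret left_handed_sba S by fact
  obtain T :: "'b set" where "card T = 2"
    using infinite_arbitrarily_large[OF inf, of 2] by auto
  then obtain z a :: 'b where za: "z \<noteq> a" by (auto simp: card_2_iff)
  let ?P = "primitive z {a}" and ?p = "D_proj S"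
  fix ys Z assume ys: "set ys \<subseteq> X \<and> Z \<subseteq> set ys"
  define f where "f P = (if P \<in> ?p ` Z then a else z)" for P
  have "f \<in> ?p ` X \<rightarrow> carrier ?P" by (auto simp: f_def primitive_def)
  moreover have "free_on TYPE('b) Generalized_Boolean (D_quotient S) (?p ` X)" and inj: "inj_on ?p X"
    using free by (simp_all add: quotient_free_on_image_def)
  ultimately have "\<exists>!k. k \<in> sba_hom (D_quotient S) ?P \<and> k \<in> extensional (carrier (D_quotient S))
      \<and> (\<forall>P\<in>?p ` X. k P = f P)"
    using generalized_boolean_primitive[of z a] unfolding free_on_def in_variety.simps
    by (elim conjE allE[of _ ?P] allE[of _ f] impE) (intro conjI)
  then obtain k where k: "k \<in> sba_hom (D_quotient S) ?P" "\<forall>P\<in>?p ` X. k P = f P" by blast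
  define h where "h = k \<circ> ?p"
  have h: "h \<in> sba_hom S ?P" unfolding h_def by (rule sba_hom_comp[OF D_proj_hom k(1)])
  have hw: "h w = (if w \<in> Z then a else z)" if "w \<in> X" for w
  proof -
    have "?p w \<in> ?p ` Z \<longleftrightarrow> w \<in> Z"
      using ys that inj_on_image_mem_iff[OF inj, of w Z] by blast
    then show ?thesis using k(2) that by (simp add: h_def f_def)
  qed
  have nz: "cut S (\<lambda>x. x) Z ys u \<noteq> \<zero>\<^bsub>S\<^esub>" if u: "u \<in> Z" for u
  proof -
    have uX: "u \<in> X" using u ys by auto
    have "h (cut S (\<lambda>x. x) Z ys u) = h u"
    proof (rule hom_primitive_cut[OF assms(1) h])
      show "h y \<noteq> z \<longleftrightarrow> y \<in> Z" if "y \<in> set ys" for y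
      proof -
        have "y \<in> X" using ys that by blast
        from hw[OF this] show ?thesis using za by auto
      qed
    qed (use ys X uX in auto)
    also have "h u = a" using hw[OF uX] u by simp
    finally show ?thesis using sba_homD(2)[OF h] za by (auto simp: primitive_def)
  qed
  have "inj_on (cut S (\<lambda>x. x) Z ys) Z"
  proof (rule inj_onI, rule ccontr)
    fix u v assume uv: "u \<in> Z" "v \<in> Z" "cut S (\<lambda>x. x) Z ys u = cut S (\<lambda>x. x) Z ys v" "u \<noteq> v"
    have X': "u \<in> X" "v \<in> X" using uv ys by auto
    have g: "w \<in> carrier S" if "w \<in> set ys" for w using that ys X by auto
    have c: "u \<in> carrier S" "v \<in> carrier S" using X' X by auto
    have b: "cut S (\<lambda>x. x) Z ys w \<in> carrier S" "nat_le S (cut S (\<lambda>x. x) Z ys w) w"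
      if "w \<in> carrier S" for w
      using g that by (auto intro!: cut_closed cut_below)
    have "cut S (\<lambda>x. x) Z ys u = \<zero>\<^bsub>S\<^esub>"
      using disj[OF X' uv(4) b[OF c(1)]] b(2)[OF c(2)] uv(3) by simp
    then show False using nz uv(1) by blast
  qed
  with nz show "inj_on (cut S (\<lambda>x. x) Z ys) Z \<and> (\<forall>u\<in>Z. cut S (\<lambda>x. x) Z ys u \<noteq> \<zero>\<^bsub>S\<^esub>)" by blast
qed


section \<open>The left-handed case\<close>

lemma is_glb_zero_iff:
  assumes "left_handed_sba S" "x \<in> carrier S" "y \<in> carrier S"
  shows "is_glb S x y \<zero>\<^bsub>S\<^esub> \<longleftrightarrow> (\<forall>a\<in>carrier S. nat_le S a x \<and> nat_le S a y \<longrightarrow> a = \<zero>\<^bsub>S\<^esub>)"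
proof -
  interpret left_handed_sba S by fact
  show ?thesis using assms(2,3) by (auto simp: is_glb_def nat_le_def)
qed

lemma left_handed_free_characterizations:
  assumes S: "left_handed_sba S" and X: "X \<subseteq> carrier S" and gen: "generated S X = carrier S"
    and inf: "infinite (UNIV :: 'b set)"
  defines "i \<equiv> free_on TYPE('b) Left_Handed S X"
    and "ii \<equiv> (\<forall>Y. finite Y \<and> Y \<subseteq> X \<longrightarrow> free_on TYPE('b) Left_Handed (generated_subalgebra S Y) Y)"
    and "iii \<equiv> (\<forall>F n. finite F \<and> F \<subseteq> X \<and> card F = n \<longrightarrow>
           card (atomic_outcomes S F) = n * 2 ^ (n - 1) \<and> zero S \<notin> atomic_outcomes S F)"
    and "iv \<equiv> quotient_free_on_image TYPE('b) S X \<and>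
           (\<forall>x\<in>X. \<forall>y\<in>X. x \<noteq> y \<longrightarrow> (\<forall>a\<in>carrier S. nat_le S a x \<and> nat_le S a y \<longrightarrow> a = zero S))"
    and "v \<equiv> quotient_free_on_image TYPE('b) S X \<and>
           (\<forall>x\<in>X. \<forall>y\<in>X. x \<noteq> y \<longrightarrow> is_glb S x y (zero S))"
  shows "(i \<longleftrightarrow> ii) \<and> (i \<longleftrightarrow> iii) \<and> (i \<longleftrightarrow> iv) \<and> (i \<longleftrightarrow> v)"
proof -
  have 1: "i \<longleftrightarrow> atoms_separated S X"
    unfolding i_def by (rule free_iff_atoms_separated[OF S X gen inf])
  have "free_on TYPE('b) Left_Handed (generated_subalgebra S Y) Y \<longleftrightarrow> atoms_separated S Y"
    if "Y \<subseteq> X" for Y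
  proof -
    have Y: "Y \<subseteq> carrier S" using that X by simp
    have "generated (generated_subalgebra S Y) Y = carrier (generated_subalgebra S Y)"
      "Y \<subseteq> carrier (generated_subalgebra S Y)"
      by (auto simp: generated_subalgebra_def intro: generated.gen)
    from free_iff_atoms_separated[OF left_handed_generated_subalgebra[OF S Y] this(2,1) inf]
    show ?thesis by (simp add: generated_subalgebra_def)
  qed
  then have 2: "ii \<longleftrightarrow> atoms_separated S X"
    unfolding ii_def using atoms_separated_iff_finite[of S X] by metis
  have 3: "iii \<longleftrightarrow> atoms_separated S X"
    unfolding iii_def by (rule atomic_outcomes_iff_atoms_separated[OF S X])
  have 4: "iv \<longleftrightarrow> atoms_separated S X"
  proof
    assume iv
    then show "atoms_separated S X"
      unfolding iv_def by (intro quotient_free_imp_atoms_separated[OF S X _ inf]) blast+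
  next
    assume sep: "atoms_separated S X"
    have "\<forall>x\<in>X. \<forall>y\<in>X. x \<noteq> y \<longrightarrow> (\<forall>a\<in>carrier S. nat_le S a x \<and> nat_le S a y \<longrightarrow> a = zero S)"
      using atoms_separated_imp_disjoint_generators[OF S X gen sep] by blast
    then show iv
      unfolding iv_def using atoms_separated_imp_quotient_free[OF S X gen sep] by blast
  qed
  have 5: "v \<longleftrightarrow> iv"
    unfolding v_def iv_def using is_glb_zero_iff[OF S] X by (meson subsetD)
  show ?thesis using 1 2 3 4 5 by simp
qed


section \<open>The opposite algebra\<close>

text \<open>
  Meet and join are both reversed; reversing only one of them breaks the absorption laws.
\<close>

definition opposite :: "'a skew_alg \<Rightarrow> 'a skew_alg" where
  "opposite S = S\<lparr>meet := \<lambda>x y. meet S y x, join := \<lambda>x y. join S y x\<rparr>"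

lemma opposite_simps [simp]:
  "carrier (opposite S) = carrier S" "zero (opposite S) = zero S"
  "meet (opposite S) x y = meet S y x" "join (opposite S) x y = join S y x"
  "diff (opposite S) = diff S"
  by (simp_all add: opposite_def)

lemma opposite_opposite [simp]: "opposite (opposite S) = S"
  by (simp add: opposite_def)

lemma skew_boolean_opposite:
  assumes "skew_boolean_algebra S"
  shows "skew_boolean_algebra (opposite S)"
proof -
  interpret skew_boolean_algebra S by fact
  note closed = meet_closed join_closed diff_closed zero_closed
  have "x \<sqinter>\<^bsub>S\<^esub> (y \<sqinter>\<^bsub>S\<^esub> x) = x \<sqinter>\<^bsub>S\<^esub> y \<sqinter>\<^bsub>S\<^esub> x" if "x \<in> carrier S" "y \<in> carrier S" for x y
    using meet_assoc that by simp
  note c = closed this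
  \<comment> \<open>The two summands \<open>x \<sqinter> y \<sqinter> x\<close> and \<open>x \<setminus> y\<close> commute, being orthogonal.\<close>
  have diff_join: "(x \<setminus>\<^bsub>S\<^esub> y) \<squnion>\<^bsub>S\<^esub> (x \<sqinter>\<^bsub>S\<^esub> y \<sqinter>\<^bsub>S\<^esub> x) = x"
    if "x \<in> carrier S" "y \<in> carrier S" for x y
  proof -
    have "(x \<sqinter>\<^bsub>S\<^esub> y \<sqinter>\<^bsub>S\<^esub> x) \<squnion>\<^bsub>S\<^esub> (x \<setminus>\<^bsub>S\<^esub> y) = (x \<setminus>\<^bsub>S\<^esub> y) \<squnion>\<^bsub>S\<^esub> (x \<sqinter>\<^bsub>S\<^esub> y \<sqinter>\<^bsub>S\<^esub> x)"
      by (rule orthogonal_join_commute) (use that in \<open>simp_all add: meet_meet_diff diff_meet_meet\<close>)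
    then show ?thesis using meet_join_diff[OF that] by simp
  qed
  show ?thesis
    by unfold_locales
      (simp_all add: c meet_join_absorb join_meet_absorb join_absorb_meet meet_absorb_join
        zero_meet meet_zero zero_join join_zero distrib_left distrib_right
        diff_join meet_meet_diff diff_meet_meet, simp_all add: closed meet_assoc join_assoc)
qed

primrec opposite_variety :: "sba_variety \<Rightarrow> sba_variety" where
  "opposite_variety Left_Handed = Right_Handed"
| "opposite_variety Right_Handed = Left_Handed"
| "opposite_variety Generalized_Boolean = Generalized_Boolean"

lemma in_variety_opposite:
  assumes "in_variety V A"
  shows "in_variety (opposite_variety V) (opposite A)"
proof (cases V)
  case Left_Handed
  then interpret left_handed_sba A using assms by simp
  interpret O: skew_boolean_algebra "opposite A"
    by (rule skew_boolean_opposite) (rule skew_boolean_algebra_axioms)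
  have "right_handed_sba (opposite A)"
    by unfold_locales (simp_all add: meet_assoc[symmetric] join_assoc[symmetric] left_meet left_join)
  then show ?thesis using Left_Handed by simp
next
  case Right_Handed
  then interpret right_handed_sba A using assms by simp
  interpret O: skew_boolean_algebra "opposite A"
    by (rule skew_boolean_opposite) (rule skew_boolean_algebra_axioms)
  have "left_handed_sba (opposite A)"
    by unfold_locales (simp_all add: meet_assoc[symmetric] join_assoc[symmetric] right_meet right_join)
  then show ?thesis using Right_Handed by simp
next
  case Generalized_Boolean
  then interpret generalized_boolean_algebra A using assms by simp
  interpret O: skew_boolean_algebra "opposite A"
    by (rule skew_boolean_opposite) (rule skew_boolean_algebra_axioms)
  have "generalized_boolean_algebra (opposite A)"
    by unfold_locales (simp_all add: meet_comm join_comm)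
  then show ?thesis using Generalized_Boolean by simp
qed

lemma opposite_variety_opposite_variety [simp]: "opposite_variety (opposite_variety V) = V"
  by (cases V) simp_all

lemma sba_hom_opposite: "sba_hom (opposite A) (opposite B) = sba_hom A B"
  by (auto simp: sba_hom_def)

lemma free_on_opposite:
  assumes "free_on TYPE('b) V A X"
  shows "free_on TYPE('b) (opposite_variety V) (opposite A) X"
  unfolding free_on_def
proof (intro conjI allI impI, goal_cases)
  case 1
  from assms have "in_variety V A" by (simp add: free_on_def)
  then show ?case by (rule in_variety_opposite)
next
  case 2
  then show ?case using assms by (simp add: free_on_def)
next
  case (3 B f)
  have "in_variety V (opposite B)" "f \<in> X \<rightarrow> carrier (opposite B)"
    using in_variety_opposite[of "opposite_variety V" B] 3 by simp_all
  then have "\<exists>!h. h \<in> sba_hom A (opposite B) \<and> h \<in> extensional (carrier A) \<and> (\<forall>x\<in>X. h x = f x)"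
    using assms unfolding free_on_def by blast
  then show ?case using sba_hom_opposite[of A "opposite B"] by simp
qed

lemma free_on_opposite_iff:
  "free_on TYPE('b) (opposite_variety V) (opposite A) X \<longleftrightarrow> free_on TYPE('b) V A X"
  using free_on_opposite[of V A X, where ?'b = 'b]
    free_on_opposite[of "opposite_variety V" "opposite A" X, where ?'b = 'b] by auto

lemma generated_opposite [simp]: "generated (opposite S) X = generated S X"
proof -
  have *: "x \<in> generated S X" if "x \<in> generated (opposite S) X" for x and S :: "'a skew_alg"
    using that by induction (auto intro: generated.intros)
  from *[of _ S] *[of _ "opposite S"] show ?thesis by auto
qed

lemma generated_subalgebra_opposite:
  "generated_subalgebra (opposite S) Y = opposite (generated_subalgebra S Y)"
  unfolding generated_subalgebra_def generated_opposite by (simp add: opposite_def)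

lemma nat_le_opposite [simp]: "nat_le (opposite S) = nat_le S"
  by (auto simp: nat_le_def fun_eq_iff)

lemma is_glb_opposite [simp]: "is_glb (opposite S) = is_glb S"
  by (auto simp: is_glb_def fun_eq_iff)

context skew_lattice
begin

lemma D_rel_opposite: "D_rel (opposite S) = D_rel S"
  by (auto simp: D_rel_def meet_assoc)

lemma D_quotient_opposite: "D_quotient (opposite S) = opposite (D_quotient S)"
proof -
  have p: "D_proj (opposite S) = D_proj S" by (simp add: D_proj_def D_rel_opposite fun_eq_iff)
  show ?thesis
  proof (rule skew_alg.equality)
    show "meet (D_quotient (opposite S)) = meet (opposite (D_quotient S))"
      by (intro ext) (simp add: D_quotient_def opposite_def[of "\<lparr>carrier = _, meet = _, join = _, diff = _, zero = _\<rparr>"] p, blast)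
    show "join (D_quotient (opposite S)) = join (opposite (D_quotient S))"
      by (intro ext) (simp add: D_quotient_def opposite_def[of "\<lparr>carrier = _, meet = _, join = _, diff = _, zero = _\<rparr>"] p, blast)
  qed (simp_all add: D_quotient_def p D_rel_opposite)
qed

lemma quotient_free_on_image_opposite:
  "quotient_free_on_image TYPE('b) (opposite S) X \<longleftrightarrow> quotient_free_on_image TYPE('b) S X"
proof -
  have "D_proj (opposite S) = D_proj S" by (simp add: D_proj_def D_rel_opposite fun_eq_iff)
  then show ?thesis
    using free_on_opposite_iff[of Generalized_Boolean "D_quotient S" "D_proj S ` X", where ?'b = 'b]
    by (simp add: quotient_free_on_image_def D_quotient_opposite)
qed

end

lemma foldl_hd_assoc:
  assumes "\<And>x y. \<lbrakk>x \<in> C; y \<in> C\<rbrakk> \<Longrightarrow> f x y \<in> C"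
    and "\<And>x y z. \<lbrakk>x \<in> C; y \<in> C; z \<in> C\<rbrakk> \<Longrightarrow> f (f x y) z = f x (f y z)"
    and "y \<in> C" "z \<in> C" "set zs \<subseteq> C"
  shows "foldl f (f y z) zs = f y (foldl f z zs)"
  using assms(3-5) by (induction zs arbitrary: z) (simp_all add: assms(1,2))

lemma foldl_rev:
  assumes "\<And>x y. \<lbrakk>x \<in> C; y \<in> C\<rbrakk> \<Longrightarrow> f x y \<in> C"
    and "\<And>x y z. \<lbrakk>x \<in> C; y \<in> C; z \<in> C\<rbrakk> \<Longrightarrow> f (f x y) z = f x (f y z)"
    and "ys \<noteq> []" "set ys \<subseteq> C"
  shows "foldl (\<lambda>x y. f y x) (hd ys) (tl ys) = foldl f (hd (rev ys)) (tl (rev ys))"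
  using assms(3,4)
proof (induction ys rule: list_nonempty_induct)
  case (cons y zs)
  obtain z ws where zs: "zs = z # ws" using cons.hyps by (cases zs) auto
  have "foldl (\<lambda>x y. f y x) y zs = f (foldl (\<lambda>x y. f y x) z ws) y"
    using foldl_hd_assoc[of C "\<lambda>x y. f y x" y z ws] assms(1,2) cons.prems by (simp add: zs)
  also have "\<dots> = f (foldl f (hd (rev zs)) (tl (rev zs))) y"
    using cons.IH cons.prems by (simp add: zs)
  also have "\<dots> = foldl f (hd (rev zs)) (tl (rev zs) @ [y])" by simp
  also have "tl (rev zs) @ [y] = tl (rev (y # zs))" using cons.hyps by simp
  also have "hd (rev zs) = hd (rev (y # zs))" using cons.hyps by simp
  finally show ?case by simp
qed simp

context skew_lattice
begin

lemma list_meet_opposite: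
  "\<lbrakk>ys \<noteq> []; set ys \<subseteq> carrier S\<rbrakk> \<Longrightarrow> list_meet (opposite S) ys = list_meet S (rev ys)"
  using foldl_rev[of "carrier S" "meet S" ys] meet_closed meet_assoc
  by (simp add: list_meet_def opposite_def)

lemma list_join_opposite:
  "\<lbrakk>ys \<noteq> []; set ys \<subseteq> carrier S\<rbrakk> \<Longrightarrow> list_join (opposite S) ys = list_join S (rev ys)"
  using foldl_rev[of "carrier S" "join S" ys] join_closed join_assoc
  by (simp add: list_join_def opposite_def)

text \<open>
  An atomic term evaluated in the opposite algebra is an atomic term of \<open>S\<close> with the positive and the
  negative variables listed in reverse order.
\<close>

lemma atomic_outcomes_opposite_subset:
  assumes "F \<subseteq> carrier S"
  shows "atomic_outcomes (opposite S) F \<subseteq> atomic_outcomes S F"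
proof
  fix t assume "t \<in> atomic_outcomes (opposite S) F"
  then obtain k ys where t: "t = atomic_term_value (opposite S) k ys" and ys: "set ys = F" "distinct ys"
    and k: "1 \<le> k" "k \<le> card F"
    by (auto simp: atomic_outcomes_def permutations_of_set_def)
  have len: "length ys = card F" using ys distinct_card[of ys] by simp
  define zs where "zs = rev (take k ys) @ rev (drop k ys)"
  have "set zs = set (take k ys @ drop k ys)" by (simp only: zs_def set_append set_rev)
  then have zs: "set zs = F" using ys(1) by simp
  have lz: "length zs = card F" using len by (simp add: zs_def)
  then have dz: "distinct zs" using zs by (simp add: card_distinct)
  have tk: "take k zs = rev (take k ys)" "drop k zs = rev (drop k ys)"
    using k len by (simp_all add: zs_def)
  have sub: "set (take k ys) \<subseteq> carrier S" "set (drop k ys) \<subseteq> carrier S"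
    using assms ys(1) set_take_subset[of k ys] set_drop_subset[of k ys] by auto
  have m: "list_meet (opposite S) (take k ys) = list_meet S (take k zs)"
    unfolding tk by (rule list_meet_opposite) (use sub k len in auto)
  have "t = atomic_term_value S k zs"
  proof (cases "k = card F")
    case True
    then show ?thesis using t m len lz by (simp add: atomic_term_value_def)
  next
    case False
    have "list_join (opposite S) (drop k ys) = list_join S (drop k zs)"
      unfolding tk by (rule list_join_opposite) (use sub k len False in auto)
    then show ?thesis using t m len lz False by (simp add: atomic_term_value_def)
  qed
  then show "t \<in> atomic_outcomes S F"
    using zs dz k by (auto simp: atomic_outcomes_def permutations_of_set_def)
qed

end

lemma atomic_outcomes_opposite:
  assumes "skew_boolean_algebra S" "F \<subseteq> carrier S"
  shows "atomic_outcomes (opposite S) F = atomic_outcomes S F"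
proof
  interpret skew_boolean_algebra S by fact
  interpret O: skew_boolean_algebra "opposite S" by (rule skew_boolean_opposite) fact
  show "atomic_outcomes (opposite S) F \<subseteq> atomic_outcomes S F"
    by (rule atomic_outcomes_opposite_subset) fact
  show "atomic_outcomes S F \<subseteq> atomic_outcomes (opposite S) F"
    using O.atomic_outcomes_opposite_subset[of F] assms(2) by simp
qed


section \<open>Both handednesses\<close>

theorem theorem6p6:
  fixes S :: "'a skew_alg" and X :: "'a set" and V :: sba_variety
  assumes "V = Left_Handed \<or> V = Right_Handed"
    and "in_variety V S"
    and "X \<subseteq> carrier S"
    and "generated S X = carrier S"
    and "infinite (UNIV :: 'b set)"
  defines "i \<equiv> free_on TYPE('b) V S X"
    and "ii \<equiv> (\<forall>Y. finite Y \<and> Y \<subseteq> X \<longrightarrow> free_on TYPE('b) V (generated_subalgebra S Y) Y)"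
    and "iii \<equiv> (\<forall>F n. finite F \<and> F \<subseteq> X \<and> card F = n \<longrightarrow>
           card (atomic_outcomes S F) = n * 2 ^ (n - 1) \<and> zero S \<notin> atomic_outcomes S F)"
    and "iv \<equiv> quotient_free_on_image TYPE('b) S X \<and>
           (\<forall>x\<in>X. \<forall>y\<in>X. x \<noteq> y \<longrightarrow> (\<forall>a\<in>carrier S. nat_le S a x \<and> nat_le S a y \<longrightarrow> a = zero S))"
    and "v \<equiv> quotient_free_on_image TYPE('b) S X \<and>
           (\<forall>x\<in>X. \<forall>y\<in>X. x \<noteq> y \<longrightarrow> is_glb S x y (zero S))"
  shows "(i \<longleftrightarrow> ii) \<and> (i \<longleftrightarrow> iii) \<and> (i \<longleftrightarrow> iv) \<and> (i \<longleftrightarrow> v)"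
proof (cases "V = Left_Handed")
  case True
  then have "left_handed_sba S" using assms(2) by simp
  from left_handed_free_characterizations[OF this assms(3-5)] show ?thesis
    unfolding i_def ii_def iii_def iv_def v_def True .
next
  case False
  then have V: "V = Right_Handed" using assms(1) by simp
  interpret right_handed_sba S using assms(2) by (simp add: V)
  have "left_handed_sba (opposite S)" using in_variety_opposite[of V S] assms(2) by (simp add: V)
  moreover have "X \<subseteq> carrier (opposite S)" "generated (opposite S) X = carrier (opposite S)"
    using assms(3,4) by simp_all
  note L0 = left_handed_free_characterizations[OF calculation(1) this assms(5)]
  have free: "free_on TYPE('b) Left_Handed (opposite A) Y \<longleftrightarrow> free_on TYPE('b) V A Y"
    for A :: "'a skew_alg" and Y
    using free_on_opposite_iff[of V A Y, where ?'b = 'b] by (simp add: V)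
  have "atomic_outcomes (opposite S) F = atomic_outcomes S F" if "F \<subseteq> X" for F
    using that assms(3) by (intro atomic_outcomes_opposite skew_boolean_algebra_axioms) auto
  then have iii: "iii \<longleftrightarrow> (\<forall>F n. finite F \<and> F \<subseteq> X \<and> card F = n \<longrightarrow>
      card (atomic_outcomes (opposite S) F) = n * 2 ^ (n - 1) \<and> zero S \<notin> atomic_outcomes (opposite S) F)"
    unfolding iii_def by metis
  from L0[unfolded opposite_simps nat_le_opposite is_glb_opposite quotient_free_on_image_opposite
      generated_subalgebra_opposite free]
  show ?thesis unfolding iii unfolding i_def ii_def iv_def v_def .
qed

end
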